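(* Let $\gamma>0$ and $P(\rho)=\rho^\gamma/\gamma$. Let an equilibrium $W(\rho):=\rho H(\rho)$ be given and assume that the function $a$ is twice continuously differentiable in a small neighbourhood around $H(\rho)$. Then, the first-order correction (first-order Chapman-Enskog expansion) to the local equilibrium approximation of the relaxed model $$ \begin{cases} \partial_t \rho + \partial_x\big(\rho\, v(\rho,z,w) \big)=0,\\ \partial_t z+\partial_x \big(z\,v(\rho,z,w)\big)=0, \\ \partial_t w + \partial_x \big(w\,v(\rho,z,w)\big)=-\dfrac{w-W(\rho)}{\varepsilon} \end{cases} \qquad\text{for}\qquad v(\rho,z,w)=\frac{z}{\rho}-a\Big(\frac{w}{\rho}\Big) P(\rho) $$ reads as $$ \begin{cases} \partial_t \rho + \partial_x \big(\rho\, v(\rho,z,W(\rho))\big)= \varepsilon\,\partial_x\big(\rho\,\mu(\rho)\,\partial_x v(\rho,z,W(\rho))\big)+\mathcal{O}(\varepsilon^2), \\ \partial_t z + \partial_x\big(z\,v(\rho,z,W(\rho))\big) = \varepsilon\,\partial_x \big(z\,\mu(\rho)\,\partial_x v(\rho,z,W(\rho))\big)+\mathcal{O}(\varepsilon^2) \end{cases} $$ with the velocity-gradient diffusion coefficient $\mu(\rho):=a'(H(\rho))\,H'(\rho)\, P(\rho)\, \rho$. It is negative, i.e. $\mu(\rho)<0$, in the case $\partial_\rho a(H(\rho))<0$ with $\gamma>0$. The first-order correction can be written, with $\mathbf u^{\mathrm{eq}}=(\rho,z)^T$, as $$ \partial_t \mathbf u^{\mathrm{eq}} + \partial_x f^{\mathrm{eq}}(\mathbf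 u^{\mathrm{eq}})=\varepsilon\, \partial_x\Big(D(\mathbf u^{\mathrm{eq}})\, \partial_x \mathbf u^{\mathrm{eq}} \Big) \quad\text{for}\quad f^{\mathrm{eq}}(\rho,z)=\begin{pmatrix} z-\rho Q(\rho) \\ \frac{z^2}{\rho}-zQ(\rho)\end{pmatrix}, $$ where the diffusion matrix reads as $$ D(\mathbf u^{\mathrm{eq}}) = \mu(\rho) \begin{pmatrix} -\big(v^{\mathrm{eq}} + Q(\rho) + q(\rho)\big) & 1 \\ -\big(v^{\mathrm{eq}} + Q(\rho)\big)\big(v^{\mathrm{eq}} + Q(\rho) + q(\rho)\big) & v^{\mathrm{eq}} + Q(\rho) \end{pmatrix} $$ with eigenvalues $$\lambda_1^{D} = 0, \qquad \lambda_2^{D}(\mathbf u^{\mathrm{eq}}) = \Big(\lambda_1^{\mathrm{eq}}(\mathbf u^{\mathrm{eq}}) - \lambda_1^{\mathrm{f}}(\mathbf u^{\mathrm{eq}})\Big) q(\rho)=-\mu(\rho)q(\rho),$$ for $Q(\rho):=a(H(\rho)) P(\rho)$, $q(\rho):=Q'(\rho)\, \rho$, and $\lambda_1^{\mathrm{eq}}(\rho,v):=v-q(\rho)$, $\lambda_1^{\mathrm{f}}(\rho,v):=v-a(H(\rho))P'(\rho)\rho$, the latter two being evaluated at $v=v^{\mathrm{eq}}$.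
   Context: Here $\rho>0$, $h=w/\rho$, and $v^{\mathrm{eq}}=v^{\mathrm{eq}}(\rho,z)=v(\rho,z,W(\rho))=\frac{z}{\rho}-a(H(\rho))P(\rho)=\frac z\rho-Q(\rho)$ is the equilibrium velocity. The equilibrium function $H$ satisfies $H'\in C^1(\mathbb{R}^+)$. Chapman-Enskog convention: one considers families of smooth solutions $(\rho,z,w)$ of the relaxed model, depending on the small parameter $\varepsilon>0$, for which $w=W(\rho)+\varepsilon w^{(1)}+\mathcal{O}(\varepsilon^2)$ as $\varepsilon\to0$, with $w^{(1)}$ expressed through $\rho,z$ and their spatial derivatives; the $\mathcal O$-terms are understood to keep their order under differentiation in $t$ and $x$. The "first-order correction" is the closed system for $(\rho,z)$ obtained by inserting this expansion and retaining the terms up to order $\varepsilon$. *)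

theory Defs
  imports "HOL-Analysis.Analysis" "HOL-Library.Landau_Symbols"
begin

section \<open>Fields on space-time\<close>

text \<open>A scalar field is a curried function of time and space, and a family of fields has the small
  parameter as an additional first argument. The domain of a field is an open set
  of pairs (time, space).\<close>

type_synonym field = "real \<Rightarrow> real \<Rightarrow> real"
type_synonym field_family = "real \<Rightarrow> field"

definition Dt :: "field \<Rightarrow> field" where
  "Dt f = (\<lambda>t x. deriv (\<lambda>s. f s x) t)"

definition Dx :: "field \<Rightarrow> field" where
  "Dx f = (\<lambda>t x. deriv (\<lambda>y. f t y) x)"

primrec C_k_field :: "nat \<Rightarrow> (real \<times> real) set \<Rightarrow> field \<Rightarrow> bool" where
  "C_k_field 0 \<Omega> f \<longleftrightarrow> continuous_on \<Omega> (\<lambda>(t, x). f t x)"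
| "C_k_field (Suc k) \<Omega> f \<longleftrightarrow>
     continuous_on \<Omega> (\<lambda>(t, x). f t x) \<and>
     (\<forall>(t, x)\<in>\<Omega>. (\<lambda>s. f s x) differentiable at t \<and> (\<lambda>y. f t y) differentiable at x) \<and>
     C_k_field k \<Omega> (Dt f) \<and> C_k_field k \<Omega> (Dx f)"

text \<open>The pure spatial derivatives of all orders at a point, as a sequence.\<close>

definition x_jet :: "field \<Rightarrow> real \<Rightarrow> real \<Rightarrow> (nat \<Rightarrow> real)" where
  "x_jet f t x = (\<lambda>k. (deriv ^^ k) (\<lambda>y. f t y) x)"


section \<open>Order symbols\<close>

text \<open>The family is of order $\varepsilon^n$ as $\varepsilon \downarrow 0$, uniformly on \<open>K\<close>: the
  product with the principal filter of \<open>K\<close> makes the constant and the threshold for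
  $\varepsilon$ independent of the point of \<open>K\<close>.\<close>

definition O_eps :: "(real \<times> real) set \<Rightarrow> nat \<Rightarrow> field_family \<Rightarrow> bool" where
  "O_eps K n f \<longleftrightarrow>
     (\<lambda>(\<epsilon>, t, x). f \<epsilon> t x) \<in> O[at_right 0 \<times>\<^sub>F principal K](\<lambda>(\<epsilon>, t, x). \<epsilon> ^ n)"

text \<open>An order term that keeps its order under up to \<open>k\<close> differentiations in time and space.\<close>

primrec O_eps_diff :: "nat \<Rightarrow> (real \<times> real) set \<Rightarrow> nat \<Rightarrow> field_family \<Rightarrow> bool" where
  "O_eps_diff 0 K n f \<longleftrightarrow> O_eps K n f"
| "O_eps_diff (Suc k) K n f \<longleftrightarrow>
     O_eps K n f \<and>
     O_eps_diff k K n (\<lambda>\<epsilon>. Dt (f \<epsilon>)) \<and> O_eps_diff k K n (\<lambda>\<epsilon>. Dx (f \<epsilon>))"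


section \<open>Constitutive functions\<close>

definition pressure :: "real \<Rightarrow> real \<Rightarrow> real" where
  "pressure \<gamma> \<rho> = \<rho> powr \<gamma> / \<gamma>"

definition W_eq :: "(real \<Rightarrow> real) \<Rightarrow> real \<Rightarrow> real" where
  "W_eq H \<rho> = \<rho> * H \<rho>"

definition velocity :: "real \<Rightarrow> (real \<Rightarrow> real) \<Rightarrow> real \<Rightarrow> real \<Rightarrow> real \<Rightarrow> real" where
  "velocity \<gamma> a \<rho> z w = z / \<rho> - a (w / \<rho>) * pressure \<gamma> \<rho>"

definition v_eq :: "real \<Rightarrow> (real \<Rightarrow> real) \<Rightarrow> (real \<Rightarrow> real) \<Rightarrow> real \<Rightarrow> real \<Rightarrow> real" where
  "v_eq \<gamma> a H \<rho> z = velocity \<gamma> a \<rho> z (W_eq H \<rho>)"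

definition diff_coeff :: "real \<Rightarrow> (real \<Rightarrow> real) \<Rightarrow> (real \<Rightarrow> real) \<Rightarrow> real \<Rightarrow> real" where
  "diff_coeff \<gamma> a H \<rho> = deriv a (H \<rho>) * deriv H \<rho> * pressure \<gamma> \<rho> * \<rho>"

definition Q_eq :: "real \<Rightarrow> (real \<Rightarrow> real) \<Rightarrow> (real \<Rightarrow> real) \<Rightarrow> real \<Rightarrow> real" where
  "Q_eq \<gamma> a H \<rho> = a (H \<rho>) * pressure \<gamma> \<rho>"

definition q_eq :: "real \<Rightarrow> (real \<Rightarrow> real) \<Rightarrow> (real \<Rightarrow> real) \<Rightarrow> real \<Rightarrow> real" where
  "q_eq \<gamma> a H \<rho> = deriv (Q_eq \<gamma> a H) \<rho> * \<rho>"

definition lambda1_eq :: "real \<Rightarrow> (real \<Rightarrow> real) \<Rightarrow> (real \<Rightarrow> real) \<Rightarrow> real \<Rightarrow> real \<Rightarrow> real" where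
  "lambda1_eq \<gamma> a H \<rho> v = v - q_eq \<gamma> a H \<rho>"

definition lambda1_f :: "real \<Rightarrow> (real \<Rightarrow> real) \<Rightarrow> (real \<Rightarrow> real) \<Rightarrow> real \<Rightarrow> real \<Rightarrow> real" where
  "lambda1_f \<gamma> a H \<rho> v = v - a (H \<rho>) * deriv (pressure \<gamma>) \<rho> * \<rho>"


section \<open>Relaxed model and Chapman-Enskog families\<close>

definition relaxed_model ::
  "real \<Rightarrow> (real \<Rightarrow> real) \<Rightarrow> (real \<Rightarrow> real) \<Rightarrow> (real \<times> real) set \<Rightarrow> real \<Rightarrow>
     field \<Rightarrow> field \<Rightarrow> field \<Rightarrow> bool" where
  "relaxed_model \<gamma> a H \<Omega> \<epsilon> \<rho> z w \<longleftrightarrow>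
     (let v = (\<lambda>t x. velocity \<gamma> a (\<rho> t x) (z t x) (w t x)) in
      \<forall>(t, x)\<in>\<Omega>.
        Dt \<rho> t x + Dx (\<lambda>t x. \<rho> t x * v t x) t x = 0 \<and>
        Dt z t x + Dx (\<lambda>t x. z t x * v t x) t x = 0 \<and>
        Dt w t x + Dx (\<lambda>t x. w t x * v t x) t x = - ((w t x - W_eq H (\<rho> t x)) / \<epsilon>))"

text \<open>Solutions on \<open>\<Omega>\<close> whose order terms are uniform on \<open>K \<subseteq> \<Omega>\<close>. The fields
  and their derivatives are of order one and the density stays away from vacuum, so that
  the orders of the individual terms are the displayed powers of $\varepsilon$. The
  first-order term of the expansion of \<open>w\<close> is the expression \<open>G\<close>, independent
  of $\varepsilon$, in \<open>\<rho>\<close>, \<open>z\<close> and their spatial derivatives.\<close>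

definition chapman_enskog_family ::
  "real \<Rightarrow> (real \<Rightarrow> real) \<Rightarrow> (real \<Rightarrow> real) \<Rightarrow> (real \<times> real) set \<Rightarrow> (real \<times> real) set \<Rightarrow>
     field_family \<Rightarrow> field_family \<Rightarrow> field_family \<Rightarrow>
     ((nat \<Rightarrow> real) \<Rightarrow> (nat \<Rightarrow> real) \<Rightarrow> real) \<Rightarrow> bool" where
  "chapman_enskog_family \<gamma> a H \<Omega> K \<rho> z w G \<longleftrightarrow>
     (let w1 = (\<lambda>\<epsilon> t x. G (x_jet (\<rho> \<epsilon>) t x) (x_jet (z \<epsilon>) t x)) in
      open \<Omega> \<and> K \<subseteq> \<Omega> \<and>
      (\<forall>\<^sub>F \<epsilon> in at_right 0.
         C_k_field 2 \<Omega> (\<rho> \<epsilon>) \<and> C_k_field 2 \<Omega> (z \<epsilon>) \<and> C_k_field 2 \<Omega> (w \<epsilon>) \<and>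
         C_k_field 1 \<Omega> (w1 \<epsilon>) \<and>
         (\<forall>(t, x)\<in>\<Omega>. \<rho> \<epsilon> t x > 0) \<and>
         relaxed_model \<gamma> a H \<Omega> \<epsilon> (\<rho> \<epsilon>) (z \<epsilon>) (w \<epsilon>)) \<and>
      O_eps_diff 2 K 0 \<rho> \<and> O_eps_diff 2 K 0 z \<and> O_eps K 0 (\<lambda>\<epsilon> t x. 1 / \<rho> \<epsilon> t x) \<and>
      O_eps_diff 1 K 0 w1 \<and>
      O_eps_diff 1 K 2 (\<lambda>\<epsilon> t x. w \<epsilon> t x - (W_eq H (\<rho> \<epsilon> t x) + \<epsilon> * w1 \<epsilon> t x)))"

text \<open>The Chapman-Enskog convention that order terms keep their order under differentiation, for
  the order terms met when the expansion of \<open>w\<close> is inserted into the velocity. The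
  undifferentiated bounds hold for every Chapman-Enskog family if \<open>a\<close> is twice continuously
  differentiable. The bounds on the last differentiation of the two velocity remainders do not follow
  from this regularity alone; a Lipschitz condition on the second derivative would be needed.\<close>

definition order_terms_differentiable ::
  "real \<Rightarrow> (real \<Rightarrow> real) \<Rightarrow> (real \<Rightarrow> real) \<Rightarrow> (real \<times> real) set \<Rightarrow>
     field_family \<Rightarrow> field_family \<Rightarrow> field_family \<Rightarrow>
     ((nat \<Rightarrow> real) \<Rightarrow> (nat \<Rightarrow> real) \<Rightarrow> real) \<Rightarrow> bool" where
  "order_terms_differentiable \<gamma> a H K \<rho> z w G \<longleftrightarrow>
     (let w1 = (\<lambda>\<epsilon> t x. G (x_jet (\<rho> \<epsilon>) t x) (x_jet (z \<epsilon>) t x));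
          v = (\<lambda>\<epsilon> t x. velocity \<gamma> a (\<rho> \<epsilon> t x) (z \<epsilon> t x) (w \<epsilon> t x));
          v0 = (\<lambda>\<epsilon> t x. v_eq \<gamma> a H (\<rho> \<epsilon> t x) (z \<epsilon> t x));
          v1 = (\<lambda>\<epsilon> t x. deriv (velocity \<gamma> a (\<rho> \<epsilon> t x) (z \<epsilon> t x)) (W_eq H (\<rho> \<epsilon> t x)) * w1 \<epsilon> t x)
      in O_eps_diff 2 K 1 (\<lambda>\<epsilon> t x. w \<epsilon> t x - W_eq H (\<rho> \<epsilon> t x)) \<and>
         O_eps_diff 2 K 1 (\<lambda>\<epsilon> t x. v \<epsilon> t x - v0 \<epsilon> t x) \<and>
         O_eps_diff 1 K 2 (\<lambda>\<epsilon> t x. v \<epsilon> t x - (v0 \<epsilon> t x + \<epsilon> * v1 \<epsilon> t x)))"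


section \<open>The first-order correction\<close>

text \<open>The transported quantity \<open>u\<close> is either the density or \<open>z\<close>.\<close>

definition equilibrium_part ::
  "real \<Rightarrow> (real \<Rightarrow> real) \<Rightarrow> (real \<Rightarrow> real) \<Rightarrow> field \<Rightarrow> field \<Rightarrow> field \<Rightarrow> field" where
  "equilibrium_part \<gamma> a H \<rho> z u =
     (\<lambda>t x. Dt u t x + Dx (\<lambda>t x. u t x * v_eq \<gamma> a H (\<rho> t x) (z t x)) t x)"

definition diffusive_flux ::
  "real \<Rightarrow> (real \<Rightarrow> real) \<Rightarrow> (real \<Rightarrow> real) \<Rightarrow> field \<Rightarrow> field \<Rightarrow> field \<Rightarrow> field" where
  "diffusive_flux \<gamma> a H \<rho> z u =
     (\<lambda>t x. u t x * diff_coeff \<gamma> a H (\<rho> t x) * Dx (\<lambda>t x. v_eq \<gamma> a H (\<rho> t x) (z t x)) t x)"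

definition first_order_correction ::
  "real \<Rightarrow> (real \<Rightarrow> real) \<Rightarrow> (real \<Rightarrow> real) \<Rightarrow> (real \<times> real) set \<Rightarrow> real \<Rightarrow>
     field \<Rightarrow> field \<Rightarrow> bool" where
  "first_order_correction \<gamma> a H \<Omega> \<epsilon> \<rho> z \<longleftrightarrow>
     (\<forall>(t, x)\<in>\<Omega>.
        equilibrium_part \<gamma> a H \<rho> z \<rho> t x = \<epsilon> * Dx (diffusive_flux \<gamma> a H \<rho> z \<rho>) t x \<and>
        equilibrium_part \<gamma> a H \<rho> z z t x = \<epsilon> * Dx (diffusive_flux \<gamma> a H \<rho> z z) t x)"

text \<open>Exact flux minus equilibrium flux plus $\varepsilon$ times diffusive flux.\<close>

definition flux_remainder ::
  "real \<Rightarrow> (real \<Rightarrow> real) \<Rightarrow> (real \<Rightarrow> real) \<Rightarrow> real \<Rightarrow>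
     field \<Rightarrow> field \<Rightarrow> field \<Rightarrow> field \<Rightarrow> field" where
  "flux_remainder \<gamma> a H \<epsilon> \<rho> z w u =
     (\<lambda>t x. u t x * velocity \<gamma> a (\<rho> t x) (z t x) (w t x)
          - u t x * v_eq \<gamma> a H (\<rho> t x) (z t x) + \<epsilon> * diffusive_flux \<gamma> a H \<rho> z u t x)"

definition state :: "field \<Rightarrow> field \<Rightarrow> real \<Rightarrow> real \<Rightarrow> real^2" where
  "state \<rho> z t x = vector [\<rho> t x, z t x]"

definition f_eq :: "real \<Rightarrow> (real \<Rightarrow> real) \<Rightarrow> (real \<Rightarrow> real) \<Rightarrow> real^2 \<Rightarrow> real^2" where
  "f_eq \<gamma> a H u =
     (let \<rho> = u $ 1; z = u $ 2
      in vector [z - \<rho> * Q_eq \<gamma> a H \<rho>, z^2 / \<rho> - z * Q_eq \<gamma> a H \<rho>])"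

definition diff_matrix :: "real \<Rightarrow> (real \<Rightarrow> real) \<Rightarrow> (real \<Rightarrow> real) \<Rightarrow> real^2 \<Rightarrow> real^2^2" where
  "diff_matrix \<gamma> a H u =
     (let \<rho> = u $ 1; z = u $ 2;
          v = v_eq \<gamma> a H \<rho> z; Q = Q_eq \<gamma> a H \<rho>; q = q_eq \<gamma> a H \<rho>
      in diff_coeff \<gamma> a H \<rho> *\<^sub>R
           vector [vector [- (v + Q + q), 1],
                   vector [- ((v + Q) * (v + Q + q)), v + Q]])"

definition first_order_correction_matrix ::
  "real \<Rightarrow> (real \<Rightarrow> real) \<Rightarrow> (real \<Rightarrow> real) \<Rightarrow> (real \<times> real) set \<Rightarrow> real \<Rightarrow>
     (real \<Rightarrow> real \<Rightarrow> real^2) \<Rightarrow> bool" where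
  "first_order_correction_matrix \<gamma> a H \<Omega> \<epsilon> u \<longleftrightarrow>
     (\<forall>(t, x)\<in>\<Omega>.
        vector_derivative (\<lambda>s. u s x) (at t) +
        vector_derivative (\<lambda>y. f_eq \<gamma> a H (u t y)) (at x) =
        \<epsilon> *\<^sub>R vector_derivative
          (\<lambda>y. diff_matrix \<gamma> a H (u t y) *v vector_derivative (\<lambda>y'. u t y') (at y)) (at x))"

definition eigenvalue_of :: "real^'n^'n \<Rightarrow> real \<Rightarrow> bool" where
  "eigenvalue_of A c \<longleftrightarrow> (\<exists>x. x \<noteq> 0 \<and> A *v x = c *\<^sub>R x)"

end

theory Submission
  imports Defs
begin

text \<open>Put \<open>e = w - W \<rho>\<close> and \<open>d = v - v0\<close>. The third equation of the relaxed model says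
  \<open>e = - \<epsilon> (w\<^sub>t + (w v)\<^sub>x)\<close>. Replacing \<open>w\<close> by \<open>W \<rho> + e\<close> and \<open>\<rho>\<^sub>t\<close> by
  \<open>- (\<rho> v)\<^sub>x\<close> leaves the exact identity \<open>e = \<epsilon> (\<rho>\<^sup>2 H' v0\<^sub>x + E)\<close> with
  \<open>E = \<rho>\<^sup>2 H' d\<^sub>x - e\<^sub>t - v e\<^sub>x - e v\<^sub>x\<close>, where every term of \<open>E\<close> is of order \<open>\<epsilon>\<close>
  because \<open>e\<close> and \<open>d\<close> are. Since \<open>d = - a' P e / \<rho> + O(\<epsilon>\<^sup>2)\<close> by Taylor's formula, the
  velocity correction of first order is \<open>- \<epsilon> \<mu> v0\<^sub>x\<close> and the flux remainder is
  \<open>O(\<epsilon>\<^sup>2)\<close>. Under the convention on order terms the same decomposition may be differentiated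
  once more in space.\<close>

section \<open>Orders of magnitude under differentiation\<close>

text \<open>The regularity of \<open>a\<close> decides how far the estimates go. One spatial
  derivative of \<open>d\<close> contains the increment of \<open>a'\<close> between
  \<open>H \<rho>\<close> and \<open>w / \<rho>\<close>, which is O(\<open>\<epsilon>\<close>) by
  the mean value theorem because \<open>a''\<close> is locally bounded. A further derivative, and
  likewise the derivative of the Taylor remainder of \<open>a\<close>, contains an increment of
  \<open>a''\<close>, which tends to zero without a rate. The differentiated statement therefore
  replaces the Taylor remainder by \<open>v - v0 - \<epsilon> v1\<close>, takes its rate from the
  convention and proves only that the derivatives exist. Existence needs its own care:
  \<open>deriv\<close> is total, so a bound on \<open>Dx f\<close> does not say that
  \<open>f\<close> is differentiable, and \<open>K\<close> is an arbitrary subset of the domain.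
  Bounds are thus kept on \<open>K\<close>, identities and differentiability on spatial
  neighbourhoods of its points. Finally, \<open>a\<close> is smooth only near each single value
  \<open>H r\<close>, with a radius depending on \<open>r\<close>. The bounds on
  \<open>\<rho>\<close> and \<open>1 / \<rho>\<close> confine the density to a compact interval, and
  compactness turns these radii into one margin for all points of \<open>K\<close> and all small
  \<open>\<epsilon>\<close>.\<close>

lemma O_eps_iff:
  "O_eps K n f \<longleftrightarrow> (\<exists>c. \<forall>\<^sub>F \<epsilon> in at_right 0. \<forall>(t, x)\<in>K. \<bar>f \<epsilon> t x\<bar> \<le> c * \<epsilon> ^ n)"
proof
  assume "O_eps K n f"
  then obtain c where "\<forall>\<^sub>F p in at_right 0 \<times>\<^sub>F principal K.
      norm (case p of (\<epsilon>, t, x) \<Rightarrow> f \<epsilon> t x) \<le> c * norm (case p of (\<epsilon>, t, x) \<Rightarrow> \<epsilon> ^ n)"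
    unfolding O_eps_def by (elim landau_o.bigE)
  from eventually_eventually_prod_filter1 [OF this]
  have "\<forall>\<^sub>F \<epsilon> in at_right 0. \<forall>(t, x)\<in>K. \<bar>f \<epsilon> t x\<bar> \<le> c * \<bar>\<epsilon> ^ n\<bar>"
    by (auto simp: eventually_principal split_beta)
  then have "\<forall>\<^sub>F \<epsilon> in at_right 0. \<forall>(t, x)\<in>K. \<bar>f \<epsilon> t x\<bar> \<le> c * \<epsilon> ^ n"
    using eventually_at_right_less [of 0] by eventually_elim auto
  then show "\<exists>c. \<forall>\<^sub>F \<epsilon> in at_right 0. \<forall>(t, x)\<in>K. \<bar>f \<epsilon> t x\<bar> \<le> c * \<epsilon> ^ n" ..
next
  assume "\<exists>c. \<forall>\<^sub>F \<epsilon> in at_right 0. \<forall>(t, x)\<in>K. \<bar>f \<epsilon> t x\<bar> \<le> c * \<epsilon> ^ n"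
  then obtain c where *: "\<forall>\<^sub>F \<epsilon> in at_right 0. \<forall>(t, x)\<in>K. \<bar>f \<epsilon> t x\<bar> \<le> c * \<epsilon> ^ n" ..
  have "\<forall>\<^sub>F \<epsilon> in at_right 0. \<forall>(t, x)\<in>K. \<bar>f \<epsilon> t x\<bar> \<le> c * \<bar>\<epsilon> ^ n\<bar>"
    using * eventually_at_right_less [of 0] by eventually_elim auto
  \<comment> \<open>The constant in a Landau bound has to be positive, hence
    \<open>max c 1\<close>.\<close>
  then show "O_eps K n f"
    unfolding O_eps_def
    by (intro landau_o.bigI [of "max c 1"])
      (force simp: eventually_prod_filter eventually_principal
        intro!: exI [of _ "\<lambda>p. p \<in> K"] order_trans [OF _ mult_right_mono [of c "max c 1"]])+
qed

lemma O_eps_cong: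
  assumes "\<forall>\<^sub>F \<epsilon> in at_right 0. \<forall>(t, x)\<in>K. f \<epsilon> t x = g \<epsilon> t x"
  shows "O_eps K n f \<longleftrightarrow> O_eps K n g"
proof -
  have "(\<forall>\<^sub>F \<epsilon> in at_right 0. \<forall>(t, x)\<in>K. \<bar>f \<epsilon> t x\<bar> \<le> c * \<epsilon> ^ n)
      \<longleftrightarrow> (\<forall>\<^sub>F \<epsilon> in at_right 0. \<forall>(t, x)\<in>K. \<bar>g \<epsilon> t x\<bar> \<le> c * \<epsilon> ^ n)" for c
    using assms by (rule eventually_cong) (force simp: split_beta)
  then show ?thesis by (simp add: O_eps_iff)
qed

lemma O_eps_I:
  assumes "\<forall>\<^sub>F \<epsilon> in at_right 0. \<forall>(t, x)\<in>K. \<bar>f \<epsilon> t x\<bar> \<le> c * \<epsilon> ^ n"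
  shows "O_eps K n f"
  using assms O_eps_iff by blast

lemma O_eps_dominated:
  assumes "O_eps K n g" "\<forall>\<^sub>F \<epsilon> in at_right 0. \<forall>(t, x)\<in>K. \<bar>f \<epsilon> t x\<bar> \<le> \<bar>g \<epsilon> t x\<bar>"
  shows "O_eps K n f"
proof -
  obtain c where "\<forall>\<^sub>F \<epsilon> in at_right 0. \<forall>(t, x)\<in>K. \<bar>g \<epsilon> t x\<bar> \<le> c * \<epsilon> ^ n"
    using assms(1) O_eps_iff by blast
  then have "\<forall>\<^sub>F \<epsilon> in at_right 0. \<forall>(t, x)\<in>K. \<bar>f \<epsilon> t x\<bar> \<le> c * \<epsilon> ^ n"
    using assms(2) by eventually_elim force
  then show ?thesis by (rule O_eps_I)
qed

lemma O_eps_add: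
  assumes "O_eps K n f" "O_eps K n g"
  shows "O_eps K n (\<lambda>\<epsilon> t x. f \<epsilon> t x + g \<epsilon> t x)"
proof -
  obtain c d where "\<forall>\<^sub>F \<epsilon> in at_right 0. \<forall>(t, x)\<in>K. \<bar>f \<epsilon> t x\<bar> \<le> c * \<epsilon> ^ n"
    "\<forall>\<^sub>F \<epsilon> in at_right 0. \<forall>(t, x)\<in>K. \<bar>g \<epsilon> t x\<bar> \<le> d * \<epsilon> ^ n"
    using assms O_eps_iff by blast
  then have "\<forall>\<^sub>F \<epsilon> in at_right 0. \<forall>(t, x)\<in>K. \<bar>f \<epsilon> t x + g \<epsilon> t x\<bar> \<le> (c + d) * \<epsilon> ^ n"
    by eventually_elim (force simp: distrib_right intro: order_trans [OF abs_triangle_ineq] add_mono)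
  then show ?thesis by (rule O_eps_I)
qed

lemma O_eps_mult:
  assumes "O_eps K n f" "O_eps K m g"
  shows "O_eps K (n + m) (\<lambda>\<epsilon> t x. f \<epsilon> t x * g \<epsilon> t x)"
proof -
  obtain c d where "\<forall>\<^sub>F \<epsilon> in at_right 0. \<forall>(t, x)\<in>K. \<bar>f \<epsilon> t x\<bar> \<le> c * \<epsilon> ^ n"
    "\<forall>\<^sub>F \<epsilon> in at_right 0. \<forall>(t, x)\<in>K. \<bar>g \<epsilon> t x\<bar> \<le> d * \<epsilon> ^ m"
    using assms O_eps_iff by blast
  then have "\<forall>\<^sub>F \<epsilon> in at_right 0. \<forall>(t, x)\<in>K. \<bar>f \<epsilon> t x * g \<epsilon> t x\<bar> \<le> (c * d) * \<epsilon> ^ (n + m)"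
  proof eventually_elim
    case (elim \<epsilon>)
    have "\<bar>f \<epsilon> t x\<bar> * \<bar>g \<epsilon> t x\<bar> \<le> (c * \<epsilon> ^ n) * (d * \<epsilon> ^ m)" if "(t, x) \<in> K" for t x
    proof -
      have "\<bar>f \<epsilon> t x\<bar> \<le> c * \<epsilon> ^ n" "\<bar>g \<epsilon> t x\<bar> \<le> d * \<epsilon> ^ m" using elim that by auto
      then show ?thesis by (intro mult_mono) auto
    qed
    then show ?case by (auto simp: abs_mult power_add algebra_simps)
  qed
  then show ?thesis by (rule O_eps_I)
qed

lemma O_eps_mono:
  assumes "O_eps K n f" "m \<le> n"
  shows "O_eps K m f"
proof -
  obtain c where c: "\<forall>\<^sub>F \<epsilon> in at_right 0. \<forall>(t, x)\<in>K. \<bar>f \<epsilon> t x\<bar> \<le> c * \<epsilon> ^ n"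
    using assms O_eps_iff by blast
  have "\<forall>\<^sub>F \<epsilon> in at_right 0. (0::real) < \<epsilon> \<and> \<epsilon> < 1"
    by (auto simp: eventually_at_right_field intro: exI [of _ 1])
  with c have "\<forall>\<^sub>F \<epsilon> in at_right 0. \<forall>(t, x)\<in>K. \<bar>f \<epsilon> t x\<bar> \<le> \<bar>c\<bar> * \<epsilon> ^ m"
  proof eventually_elim
    case (elim \<epsilon>)
    \<comment> \<open>If \<open>K\<close> is empty, \<open>c\<close> may be negative, hence
      \<open>\<bar>c\<bar>\<close>. The restriction to \<open>\<epsilon> < 1\<close> makes the
      powers decrease in the exponent.\<close>
    have "c * \<epsilon> ^ n \<le> \<bar>c\<bar> * \<epsilon> ^ m"
      using elim assms(2) by (intro mult_mono power_decreasing) auto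
    then show ?case using elim by force
  qed
  then show ?thesis by (rule O_eps_I)
qed

lemma O_eps_const: "O_eps K 0 (\<lambda>\<epsilon> t x. c)"
  by (rule O_eps_I [of _ _ "\<bar>c\<bar>"]) auto

lemma O_eps_parameter: "O_eps K 1 (\<lambda>\<epsilon> t x. \<epsilon>)"
  using eventually_at_right_less [of "0::real"]
  by (intro O_eps_I [of _ _ 1]) (auto elim: eventually_mono)

lemma O_eps_singleton: "O_eps {p} 0 (\<lambda>\<epsilon>. f)"
  by (rule O_eps_I [of _ _ "\<bar>f (fst p) (snd p)\<bar>"]) auto

text \<open>At one point a value independent of \<open>\<epsilon>\<close> is its own bound. This
  lets the calculus of orders be applied to a single fixed field, where it yields differentiability
  alone.\<close>

lemma O_eps_diff_singleton: "O_eps_diff k {p} 0 (\<lambda>\<epsilon>. f)"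
  by (induction k arbitrary: f) (auto simp: O_eps_singleton)

text \<open>The threshold for \<open>\<epsilon>\<close> is uniform on \<open>K\<close>, while the
  neighbourhood may shrink with \<open>\<epsilon>\<close> and the point. Time stays fixed, since
  only spatial derivatives are formed from such statements.\<close>

definition near :: "(real \<times> real) set \<Rightarrow> (real \<Rightarrow> real \<Rightarrow> real \<Rightarrow> bool) \<Rightarrow> bool" where
  "near K P \<longleftrightarrow> (\<forall>\<^sub>F \<epsilon> in at_right 0. \<forall>(t, x)\<in>K. \<forall>\<^sub>F y in nhds x. P \<epsilon> t y)"

lemma near_conj:
  assumes "near K P" "near K Q"
  shows "near K (\<lambda>\<epsilon> t y. P \<epsilon> t y \<and> Q \<epsilon> t y)"
  using assms unfolding near_def by eventually_elim (auto intro: eventually_conj)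

lemma near_mono: "near K P \<Longrightarrow> (\<And>\<epsilon> t y. P \<epsilon> t y \<Longrightarrow> Q \<epsilon> t y) \<Longrightarrow> near K Q"
  unfolding near_def by (fast elim: eventually_mono)

lemma near_at: "near K P \<Longrightarrow> \<forall>\<^sub>F \<epsilon> in at_right 0. \<forall>(t, x)\<in>K. P \<epsilon> t x"
  unfolding near_def by (auto elim!: eventually_mono dest: eventually_nhds_x_imp_x)

text \<open>A neighbourhood is also one of its nearby points; hence an identity that holds
  \<open>near K\<close> may be differentiated and still holds \<open>near K\<close>.\<close>

lemma near_near: "near K P \<Longrightarrow> near K (\<lambda>\<epsilon> t y. \<forall>\<^sub>F s in nhds y. P \<epsilon> t s)"
  unfolding near_def by (simp add: eventually_eventually)

lemma Dx_cong:
  "\<forall>\<^sub>F s in nhds y. f t s = g t s \<Longrightarrow> Dx f t y = Dx g t y"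
  unfolding Dx_def by (rule deriv_cong_ev) auto

lemma near_Dx_cong:
  "near K (\<lambda>\<epsilon> t y. f \<epsilon> t y = g \<epsilon> t y) \<Longrightarrow> near K (\<lambda>\<epsilon> t y. Dx (f \<epsilon>) t y = Dx (g \<epsilon>) t y)"
  by (drule near_near) (auto elim: near_mono intro: Dx_cong)

text \<open>Only the points of \<open>K\<close> are estimated; differentiability in space is required in a
  neighbourhood of each of them, so that the next derivative makes sense.\<close>

primrec X_order :: "nat \<Rightarrow> (real \<times> real) set \<Rightarrow> nat \<Rightarrow> field_family \<Rightarrow> bool" where
  "X_order 0 K n f \<longleftrightarrow> O_eps K n f"
| "X_order (Suc k) K n f \<longleftrightarrow>
     O_eps K n f \<and> near K (\<lambda>\<epsilon> t y. f \<epsilon> t differentiable at y) \<and> X_order k K n (\<lambda>\<epsilon>. Dx (f \<epsilon>))"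

lemma X_order_O_eps: "X_order k K n f \<Longrightarrow> O_eps K n f"
  by (cases k) auto

lemma X_order_SucD: "X_order (Suc k) K n f \<Longrightarrow> X_order k K n f"
  by (induction k arbitrary: f) auto

lemma X_order_mono:
  "X_order k K n f \<Longrightarrow> j \<le> k \<Longrightarrow> m \<le> n \<Longrightarrow> X_order j K m f"
proof (induction j arbitrary: f k)
  case 0
  then show ?case by (auto intro: O_eps_mono X_order_O_eps)
next
  case (Suc j)
  then obtain i where "k = Suc i" "j \<le> i" by (metis Suc_le_D Suc_le_mono)
  with Suc show ?case by (auto intro: O_eps_mono)
qed

lemma differentiable_cong_nhds:
  fixes f g :: "real \<Rightarrow> real"
  assumes "\<forall>\<^sub>F s in nhds y. f s = g s" "f differentiable at y"
  shows "g differentiable at y"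
  using assms DERIV_cong_ev [OF refl assms(1) refl]
  by (simp add: real_differentiable_def)

text \<open>Equality on neighbourhoods passes to the derivatives, so it can be used at every level
  of the recursion. The instance \<open>k = 0\<close> serves to rewrite plain order
  estimates.\<close>

lemma X_order_cong:
  assumes "near K (\<lambda>\<epsilon> t y. f \<epsilon> t y = g \<epsilon> t y)" "X_order k K n f"
  shows "X_order k K n g"
  using assms
proof (induction k arbitrary: f g)
  case 0
  then show ?case using O_eps_cong [OF near_at] by auto
next
  case (Suc k)
  have "near K (\<lambda>\<epsilon> t y. g \<epsilon> t differentiable at y)"
    using near_conj [OF near_near [OF Suc.prems(1)], of "\<lambda>\<epsilon> t y. f \<epsilon> t differentiable at y"] Suc.prems(2)
    by (auto elim!: near_mono intro: differentiable_cong_nhds)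
  then show ?case
    using Suc O_eps_cong [OF near_at [OF Suc.prems(1)]] near_Dx_cong [OF Suc.prems(1)] by auto
qed

lemma Dx_add:
  "f t differentiable at y \<Longrightarrow> g t differentiable at y \<Longrightarrow>
    Dx (\<lambda>t x. f t x + g t x) t y = Dx f t y + Dx g t y"
  unfolding Dx_def
  by (rule DERIV_imp_deriv, rule derivative_eq_intros)
    (auto simp: DERIV_deriv_iff_real_differentiable)

lemma Dx_mult:
  "f t differentiable at y \<Longrightarrow> g t differentiable at y \<Longrightarrow>
    Dx (\<lambda>t x. f t x * g t x) t y = Dx f t y * g t y + f t y * Dx g t y"
  by (simp add: Dx_def deriv_mult field_differentiable_def real_differentiable_def)

lemma X_order_add:
  assumes "X_order k K n f" "X_order k K n g"
  shows "X_order k K n (\<lambda>\<epsilon> t x. f \<epsilon> t x + g \<epsilon> t x)"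
  using assms
proof (induction k arbitrary: f g)
  case 0
  then show ?case by (auto intro: O_eps_add)
next
  case (Suc k)
  have d: "near K (\<lambda>\<epsilon> t y. f \<epsilon> t differentiable at y \<and> g \<epsilon> t differentiable at y)"
    using Suc.prems by (auto intro: near_conj)
  have "near K (\<lambda>\<epsilon> t y. (\<lambda>s. f \<epsilon> t s + g \<epsilon> t s) differentiable at y)"
    using d by (auto elim: near_mono)
  moreover have "X_order k K n (\<lambda>\<epsilon>. Dx (\<lambda>t x. f \<epsilon> t x + g \<epsilon> t x))"
    by (rule X_order_cong [OF near_mono [OF d] Suc.IH]) (use Suc.prems in \<open>auto simp: Dx_add\<close>)
  ultimately show ?case using Suc.prems by (auto intro: O_eps_add)
qed

lemma X_order_mult:
  assumes "X_order k K n f" "X_order k K m g"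
  shows "X_order k K (n + m) (\<lambda>\<epsilon> t x. f \<epsilon> t x * g \<epsilon> t x)"
  using assms
proof (induction k arbitrary: f g)
  case 0
  then show ?case by (auto intro: O_eps_mult)
next
  case (Suc k)
  have d: "near K (\<lambda>\<epsilon> t y. f \<epsilon> t differentiable at y \<and> g \<epsilon> t differentiable at y)"
    using Suc.prems by (auto intro: near_conj)
  have "near K (\<lambda>\<epsilon> t y. (\<lambda>s. f \<epsilon> t s * g \<epsilon> t s) differentiable at y)"
    using d by (auto elim: near_mono)
  moreover have "X_order k K (n + m) (\<lambda>\<epsilon> t x. Dx (f \<epsilon>) t x * g \<epsilon> t x + f \<epsilon> t x * Dx (g \<epsilon>) t x)"
    using Suc.prems X_order_SucD [OF Suc.prems(1)] X_order_SucD [OF Suc.prems(2)]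
    by (intro X_order_add Suc.IH) auto
  then have "X_order k K (n + m) (\<lambda>\<epsilon>. Dx (\<lambda>t x. f \<epsilon> t x * g \<epsilon> t x))"
    by (rule X_order_cong [OF near_mono [OF d], rotated]) (auto simp: Dx_mult)
  ultimately show ?case using Suc.prems by (auto intro: O_eps_mult)
qed

lemma X_order_const: "X_order k K 0 (\<lambda>\<epsilon> t x. c)"
proof (induction k arbitrary: c)
  case (Suc k)
  have "Dx (\<lambda>t x. c) = (\<lambda>t x. 0)" by (simp add: Dx_def)
  then show ?case using Suc by (auto simp: O_eps_const near_def)
qed (simp add: O_eps_const)

lemma X_order_parameter: "X_order k K 1 (\<lambda>\<epsilon> t x. \<epsilon>)"
proof (cases k)
  case (Suc j)
  have "Dx (\<lambda>t x. c) = (\<lambda>t x. 0 * c)" for c by (simp add: Dx_def)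
  \<comment> \<open>A constant has order 0 in general; only the zero field, the derivative of the
    parameter, has order 1.\<close>
  moreover have "X_order j K 1 (\<lambda>\<epsilon> t x. 0)"
  proof (induction j)
    case 0
    show ?case by (auto intro: O_eps_I [of _ _ 0])
  next
    case (Suc j)
    have "Dx (\<lambda>t x. 0) = (\<lambda>t x. 0)" by (simp add: Dx_def)
    then show ?case using Suc by (auto simp: near_def intro: O_eps_I [of _ _ 0])
  qed
  ultimately show ?thesis using Suc O_eps_parameter by (auto simp: near_def)
qed (use O_eps_parameter in simp)

lemma X_order_diff:
  assumes "X_order k K n f" "X_order k K n g"
  shows "X_order k K n (\<lambda>\<epsilon> t x. f \<epsilon> t x - g \<epsilon> t x)"
  using X_order_add [OF assms(1) X_order_mult [OF X_order_const [of _ _ "-1"] assms(2), simplified]] by simp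

lemma X_order_minus:
  assumes "X_order k K n f"
  shows "X_order k K n (\<lambda>\<epsilon> t x. - f \<epsilon> t x)"
  using X_order_mult [OF X_order_const [of _ _ "-1"] assms] by simp

section \<open>Linearity of the partial derivatives, and regularity inherited from the
  domain\<close>

lemma Dt_diff:
  "(\<lambda>s. f s y) differentiable at t \<Longrightarrow> (\<lambda>s. g s y) differentiable at t \<Longrightarrow>
    Dt (\<lambda>t x. f t x - g t x) t y = Dt f t y - Dt g t y"
  by (simp add: Dt_def deriv_diff field_differentiable_def real_differentiable_def)

lemma Dt_add:
  "(\<lambda>s. f s y) differentiable at t \<Longrightarrow> (\<lambda>s. g s y) differentiable at t \<Longrightarrow>
    Dt (\<lambda>t x. f t x + g t x) t y = Dt f t y + Dt g t y"
  by (simp add: Dt_def deriv_add field_differentiable_def real_differentiable_def)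

lemma Dx_diff:
  "f t differentiable at y \<Longrightarrow> g t differentiable at y \<Longrightarrow>
    Dx (\<lambda>t x. f t x - g t x) t y = Dx f t y - Dx g t y"
  by (simp add: Dx_def deriv_diff field_differentiable_def real_differentiable_def)

lemma Dt_cmult:
  "(\<lambda>s. f s y) differentiable at t \<Longrightarrow> Dt (\<lambda>t x. c * f t x) t y = c * Dt f t y"
  by (simp add: Dt_def deriv_cmult field_differentiable_def real_differentiable_def)

lemma Dx_cmult:
  "f t differentiable at y \<Longrightarrow> Dx (\<lambda>t x. c * f t x) t y = c * Dx f t y"
  by (simp add: Dx_def deriv_cmult field_differentiable_def real_differentiable_def)

lemma X_order_1_differentiable:
  "X_order 1 K n f \<Longrightarrow> near K (\<lambda>\<epsilon> t y. f \<epsilon> t differentiable at y)"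
  by simp

lemma X_order_2_differentiable:
  "X_order 2 K n f \<Longrightarrow> near K (\<lambda>\<epsilon> t y. f \<epsilon> t differentiable at y)"
  by (simp add: numeral_2_eq_2)

lemma X_order_1_Dx: "X_order 1 K n f \<Longrightarrow> O_eps K n (\<lambda>\<epsilon>. Dx (f \<epsilon>))"
  by simp

lemma near_positive_parameter: "near K (\<lambda>\<epsilon> t y. \<epsilon> > 0)"
  unfolding near_def using eventually_at_right_less [of "0::real"] by eventually_elim auto

text \<open>The slice of an open set at a fixed time is open in space, being a preimage under
  \<open>y \<mapsto> (t, y)\<close>.\<close>

lemma near_in_domain:
  assumes "open \<Omega>" "K \<subseteq> \<Omega>" "\<forall>\<^sub>F \<epsilon> in at_right 0. \<forall>(t, x)\<in>\<Omega>. P \<epsilon> t x"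
  shows "near K P"
  unfolding near_def using assms(3)
proof eventually_elim
  case (elim \<epsilon>)
  have "\<forall>\<^sub>F y in nhds x. P \<epsilon> t y" if "(t, x) \<in> K" for t x
  proof -
    have "open {y. (t, y) \<in> \<Omega>}"
      using open_vimage [OF assms(1), of "\<lambda>y. (t, y)"]
      by (auto simp: vimage_def continuous_on_Pair)
    then show ?thesis
      by (rule eventually_mono [OF eventually_nhds_in_open]) (use assms(2) that elim in auto)
  qed
  then show ?case by blast
qed

lemma near_C_k_field:
  assumes "open \<Omega>" "K \<subseteq> \<Omega>" "\<forall>\<^sub>F \<epsilon> in at_right 0. C_k_field (Suc k) \<Omega> (f \<epsilon>)"
  shows "near K (\<lambda>\<epsilon> t y. (\<lambda>s. f \<epsilon> s y) differentiable at t \<and> f \<epsilon> t differentiable at y)"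
  using assms(3) by (intro near_in_domain [OF assms(1,2)]) (auto elim!: eventually_mono)

lemma C_k_field_near_differentiable:
  assumes "open \<Omega>" "K \<subseteq> \<Omega>" "\<forall>\<^sub>F \<epsilon> in at_right 0. C_k_field (Suc k) \<Omega> (f \<epsilon>)"
  shows "near K (\<lambda>\<epsilon> t y. f \<epsilon> t differentiable at y)"
  by (rule near_mono [OF near_C_k_field [OF assms]]) simp

text \<open>The two hypotheses complement each other: \<open>O_eps_diff\<close> bounds the values of
  the derivatives, and \<open>C_k_field\<close> guarantees that these derivatives exist near
  \<open>K\<close>.\<close>

lemma X_order_C_k_field:
  assumes "open \<Omega>" "K \<subseteq> \<Omega>"
  shows "\<forall>\<^sub>F \<epsilon> in at_right 0. C_k_field k \<Omega> (f \<epsilon>) \<Longrightarrow> O_eps_diff k K n f \<Longrightarrow> X_order k K n f"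
proof (induction k arbitrary: f)
  case (Suc k)
  moreover have "\<forall>\<^sub>F \<epsilon> in at_right 0. C_k_field k \<Omega> (Dx (f \<epsilon>))"
    using Suc.prems(1) by (auto elim: eventually_mono)
  ultimately show ?case
    using C_k_field_near_differentiable [OF assms, of k f] by simp
qed simp

lemma X_order_2D: "X_order 2 K n f \<Longrightarrow> X_order 1 K n f"
  by (erule X_order_mono) simp_all

section \<open>Composition with smooth functions\<close>

text \<open>Smoothness is expressed by iterating \<open>deriv\<close>, in parallel to the recursion
  of \<open>X_order\<close>, so that the composition rule is a single induction.\<close>

primrec C_fun :: "nat \<Rightarrow> real set \<Rightarrow> (real \<Rightarrow> real) \<Rightarrow> bool" where
  "C_fun 0 S g \<longleftrightarrow> continuous_on S g"
| "C_fun (Suc k) S g \<longleftrightarrow> (\<forall>s\<in>S. g differentiable at s) \<and> C_fun k S (deriv g)"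

lemma C_fun_continuous: "C_fun k S g \<Longrightarrow> continuous_on S g"
  by (cases k) (auto intro!: continuous_at_imp_continuous_on differentiable_imp_continuous_within)

lemma C_fun_SucD: "C_fun (Suc k) S g \<Longrightarrow> C_fun k S g"
  by (induction k arbitrary: g) (auto intro!: continuous_at_imp_continuous_on differentiable_imp_continuous_within)

lemma C_fun_cong:
  assumes "open S" "\<And>s. s \<in> S \<Longrightarrow> f s = g s" "C_fun k S f"
  shows "C_fun k S g"
  using assms(2,3)
proof (induction k arbitrary: f g)
  case 0
  then show ?case by (auto intro: continuous_on_eq)
next
  case (Suc k)
  have ev: "\<forall>\<^sub>F y in nhds s. f y = g y" if "s \<in> S" for s
    using eventually_nhds_in_open [OF assms(1) that] Suc.prems(1) by (auto elim: eventually_mono)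
  have "deriv f s = deriv g s" if "s \<in> S" for s
    using ev [OF that] by (rule deriv_cong_ev) simp
  then show ?case
    using Suc ev differentiable_cong_nhds by (metis C_fun.simps(2))
qed

text \<open>The family of all \<open>c * s powr p\<close> is closed under differentiation, so the
  induction runs over it; the reciprocal and the pressure are members.\<close>

lemma C_fun_powr: "C_fun k {0<..} (\<lambda>s. c * s powr p)"
proof (induction k arbitrary: c p)
  case (Suc k)
  have D: "((\<lambda>s. c * s powr p) has_real_derivative (c * p) * s powr (p - 1)) (at s)"
    if "s > 0" for s
    using that by (auto intro!: derivative_eq_intros simp: powr_diff)
  then have "C_fun k {0<..} (deriv (\<lambda>s. c * s powr p))"
    by (intro C_fun_cong [OF _ _ Suc [of "c * p" "p - 1"]]) (auto simp: DERIV_imp_deriv [OF D])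
  then show ?case using D by (auto simp: real_differentiable_def)
qed (auto intro!: continuous_intros)

lemma C_fun_inverse: "C_fun k {0<..} (\<lambda>s. 1 / s)"
  by (rule C_fun_cong [OF _ _ C_fun_powr [of _ 1 "-1"]]) (auto simp: powr_minus divide_simps)

lemma C_fun_pressure: "C_fun k {0<..} (pressure \<gamma>)"
  by (rule C_fun_cong [OF _ _ C_fun_powr [of _ "1 / \<gamma>" \<gamma>]]) (auto simp: pressure_def)

section \<open>Chain rule and composition with uniform bounds\<close>

lemma Dx_compose:
  "f t differentiable at y \<Longrightarrow> g differentiable at (f t y) \<Longrightarrow>
    Dx (\<lambda>t x. g (f t x)) t y = deriv g (f t y) * Dx f t y"
  unfolding Dx_def
  by (rule DERIV_imp_deriv, rule DERIV_chain2 [of g _ "f t"])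
    (auto simp: DERIV_deriv_iff_real_differentiable)

lemma Dt_compose:
  "(\<lambda>s. f s y) differentiable at t \<Longrightarrow> g differentiable at (f t y) \<Longrightarrow>
    Dt (\<lambda>t x. g (f t x)) t y = deriv g (f t y) * Dt f t y"
  unfolding Dt_def
  by (rule DERIV_imp_deriv, rule DERIV_chain2 [of g _ "\<lambda>s. f s y"])
    (auto simp: DERIV_deriv_iff_real_differentiable)

lemma differentiable_compose_real:
  fixes f g :: "real \<Rightarrow> real"
  shows "f differentiable at y \<Longrightarrow> g differentiable at (f y) \<Longrightarrow> (\<lambda>s. g (f s)) differentiable at y"
  using differentiable_chain_at [of f y g] by (simp add: o_def)

lemma near_in_open:
  assumes "open S" "near K (\<lambda>\<epsilon> t y. f \<epsilon> t differentiable at y)"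
    "\<forall>\<^sub>F \<epsilon> in at_right 0. \<forall>(t, x)\<in>K. f \<epsilon> t x \<in> S"
  shows "near K (\<lambda>\<epsilon> t y. f \<epsilon> t y \<in> S)"
  unfolding near_def using near_at [OF assms(2)] assms(3)
proof eventually_elim
  case (elim \<epsilon>)
  have "\<forall>\<^sub>F y in nhds x. f \<epsilon> t y \<in> S" if "(t, x) \<in> K" for t x
  proof -
    have "isCont (f \<epsilon> t) x" "f \<epsilon> t x \<in> S"
      using elim that by (auto intro: differentiable_imp_continuous_within)
    then show ?thesis
      using assms(1) unfolding continuous_at_open eventually_nhds by meson
  qed
  then show ?case by blast
qed

lemma compact_bound:
  fixes g :: "'a::topological_space \<Rightarrow> real"
  assumes "compact C" "continuous_on C g"
  shows "\<exists>B. \<forall>s\<in>C. \<bar>g s\<bar> \<le> B"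
  using compact_imp_bounded [OF compact_continuous_image [OF assms(2,1)]]
  by (auto simp: bounded_iff)

lemma O_eps_compose:
  assumes "compact C" "continuous_on C g" "\<forall>\<^sub>F \<epsilon> in at_right 0. \<forall>(t, x)\<in>K. f \<epsilon> t x \<in> C"
  shows "O_eps K 0 (\<lambda>\<epsilon> t x. g (f \<epsilon> t x))"
proof -
  obtain B where "\<And>s. s \<in> C \<Longrightarrow> \<bar>g s\<bar> \<le> B"
    using compact_bound [OF assms(1,2)] by blast
  then show ?thesis
    using assms(3) by (intro O_eps_I [of _ _ B]) (auto elim!: eventually_mono)
qed

text \<open>The two sets have different tasks. The compact \<open>C\<close> contains the values on
  \<open>K\<close> and bounds the derivatives of \<open>g\<close>; by continuity of \<open>f\<close>
  the open \<open>S\<close> contains the values nearby, so that the chain rule holds on a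
  neighbourhood. The induction passes from \<open>g\<close> to \<open>deriv g\<close> in the product
  \<open>g'(f) * Dx f\<close>.\<close>

lemma X_order_compose:
  assumes "open S" "compact C" "C \<subseteq> S"
    and "\<forall>\<^sub>F \<epsilon> in at_right 0. \<forall>(t, x)\<in>K. f \<epsilon> t x \<in> C"
    and "C_fun k S g" "X_order k K 0 f"
  shows "X_order k K 0 (\<lambda>\<epsilon> t x. g (f \<epsilon> t x))"
  using assms(5,6)
proof (induction k arbitrary: g)
  case 0
  then show ?case
    using assms(2-4) by (auto intro!: O_eps_compose [of C g] elim: continuous_on_subset)
next
  case (Suc k)
  have "\<forall>\<^sub>F \<epsilon> in at_right 0. \<forall>(t, x)\<in>K. f \<epsilon> t x \<in> S"
    using assms(3,4) by (auto elim!: eventually_mono)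
  then have d: "near K (\<lambda>\<epsilon> t y. f \<epsilon> t differentiable at y \<and> g differentiable at (f \<epsilon> t y))"
    using near_conj [OF _ near_in_open [OF assms(1), of K f], of "\<lambda>\<epsilon> t y. f \<epsilon> t differentiable at y"]
      Suc.prems by (auto elim: near_mono)
  have "X_order k K 0 (\<lambda>\<epsilon> t x. deriv g (f \<epsilon> t x))"
    using Suc.prems(1) X_order_SucD [OF Suc.prems(2)] by (intro Suc.IH [of "deriv g"]) simp_all
  then have "X_order k K (0 + 0) (\<lambda>\<epsilon> t x. deriv g (f \<epsilon> t x) * Dx (f \<epsilon>) t x)"
    by (rule X_order_mult) (use Suc.prems(2) in simp)
  then have "X_order k K (0 + 0) (\<lambda>\<epsilon>. Dx (\<lambda>t x. g (f \<epsilon> t x)))"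
    by (rule X_order_cong [OF near_mono [OF d], rotated]) (simp add: Dx_compose)
  moreover have "O_eps K 0 (\<lambda>\<epsilon> t x. g (f \<epsilon> t x))"
    using assms(2-4) C_fun_continuous [OF Suc.prems(1)]
    by (auto intro!: O_eps_compose [of C g] elim: continuous_on_subset)
  moreover have "near K (\<lambda>\<epsilon> t y. (\<lambda>s. g (f \<epsilon> t s)) differentiable at y)"
    using d by (auto elim!: near_mono intro: differentiable_compose_real)
  ultimately show ?case by simp
qed

section \<open>Mean value and Taylor estimates\<close>

lemma increment_bound:
  fixes g :: "real \<Rightarrow> real"
  assumes "closed_segment p q \<subseteq> C" "\<And>s. s \<in> C \<Longrightarrow> g differentiable at s"
    and "\<And>s. s \<in> C \<Longrightarrow> \<bar>deriv g s\<bar> \<le> B"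
  shows "\<bar>g q - g p\<bar> \<le> B * \<bar>q - p\<bar>"
  using field_differentiable_bound [of "closed_segment p q" g "deriv g" B p q] assms
  by (auto simp: DERIV_deriv_iff_real_differentiable subset_iff has_field_derivative_at_within
      norm_minus_commute abs_minus_commute)

text \<open>The mean value inequality is applied twice: to \<open>deriv g\<close>, and then to
  \<open>g s - deriv g p * s\<close>, whose derivative is the increment just estimated. The factor
  1/2 of Taylor's formula is given away.\<close>

lemma taylor_remainder_bound:
  fixes g :: "real \<Rightarrow> real"
  assumes "closed_segment p q \<subseteq> C" "\<And>s. s \<in> C \<Longrightarrow> g differentiable at s"
    and "\<And>s. s \<in> C \<Longrightarrow> deriv g differentiable at s"
    and "\<And>s. s \<in> C \<Longrightarrow> \<bar>deriv (deriv g) s\<bar> \<le> B"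
  shows "\<bar>g q - g p - deriv g p * (q - p)\<bar> \<le> B * (q - p)\<^sup>2"
proof -
  have D: "((\<lambda>s. g s - deriv g p * s) has_real_derivative deriv g s - deriv g p) (at s)"
    if "s \<in> C" for s
    using assms(2) [OF that]
    by (auto intro!: derivative_eq_intros simp: DERIV_deriv_iff_real_differentiable)
  have B: "0 \<le> B" using assms(4) [of p] assms(1) by force
  have "\<bar>deriv g s - deriv g p\<bar> \<le> B * \<bar>q - p\<bar>" if "s \<in> closed_segment p q" for s
  proof -
    have "closed_segment p s \<subseteq> C"
      using that assms(1) by (metis ends_in_segment(1) subset_closed_segment subset_trans)
    then have "\<bar>deriv g s - deriv g p\<bar> \<le> B * \<bar>s - p\<bar>"
      using assms(3,4) by (intro increment_bound [of _ _ C]) auto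
    also have "\<dots> \<le> B * \<bar>q - p\<bar>"
      using segment_bound(1) [OF that] B by (intro mult_left_mono) (auto simp: norm_minus_commute)
    finally show ?thesis .
  qed
  moreover have "(\<lambda>s. g s - deriv g p * s) differentiable at s"
    "deriv (\<lambda>s. g s - deriv g p * s) s = deriv g s - deriv g p" if "s \<in> C" for s
    using D [OF that] by (auto simp: DERIV_imp_deriv real_differentiable_def)
  ultimately have "\<bar>(g q - deriv g p * q) - (g p - deriv g p * p)\<bar> \<le> (B * \<bar>q - p\<bar>) * \<bar>q - p\<bar>"
    using assms(1)
    by (intro increment_bound [of p q "closed_segment p q" "\<lambda>s. g s - deriv g p * s"])
      (simp_all add: subset_iff)
  then show ?thesis by (simp add: algebra_simps power2_eq_square)
qed

text \<open>Translates the smoothness hypotheses of the theorem. On an open set the continuous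
  derivative asserted by \<open>C1_differentiable_on\<close> must coincide with
  \<open>deriv\<close>.\<close>

lemma C_fun_2_iff:
  assumes "open S"
  shows "C_fun 2 S g \<longleftrightarrow> g differentiable_on S \<and> deriv g C1_differentiable_on S"
proof -
  have "deriv g C1_differentiable_on S \<longleftrightarrow> C_fun 1 S (deriv g)"
  proof
    assume "deriv g C1_differentiable_on S"
    then obtain D where D: "\<And>s. s \<in> S \<Longrightarrow> (deriv g has_real_derivative D s) (at s)"
      "continuous_on S D"
      unfolding C1_differentiable_on_def has_real_derivative_iff_has_vector_derivative by metis
    have "continuous_on S (deriv (deriv g))"
      by (rule continuous_on_eq [OF D(2)]) (simp add: DERIV_imp_deriv [OF D(1)])
    then show "C_fun 1 S (deriv g)"
      using D(1) by (auto simp: real_differentiable_def)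
  next
    assume "C_fun 1 S (deriv g)"
    then show "deriv g C1_differentiable_on S"
      unfolding C1_differentiable_on_def
      by (intro exI [of _ "deriv (deriv g)"])
        (auto simp: DERIV_deriv_iff_real_differentiable
          simp flip: has_real_derivative_iff_has_vector_derivative)
  qed
  then show ?thesis
    using assms by (auto simp: numeral_2_eq_2 differentiable_on_eq_differentiable_at)
qed

section \<open>Constitutive functions and bounded states\<close>

locale constitutive =
  fixes \<gamma> :: real and a H :: "real \<Rightarrow> real"
  assumes \<gamma>_pos: "\<gamma> > 0"
    and H_smooth: "C_fun 2 {0<..} H"
    and a_smooth: "\<And>r. r > 0 \<Longrightarrow> \<exists>\<delta>>0. C_fun 2 (ball (H r) \<delta>) a"
begin

text \<open>The radii in \<open>a_smooth\<close> vary with \<open>r\<close>. Collecting all open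
  sets on which \<open>a\<close> is smooth gives one open set that contains the range of
  \<open>H\<close> on the positive half-line, and compactness arguments can take place inside
  it.\<close>

definition regular :: "real set" where
  "regular = \<Union>{S. open S \<and> C_fun 2 S a}"

lemma open_regular: "open regular"
  by (auto simp: regular_def)

lemma H_regular: "r > 0 \<Longrightarrow> H r \<in> regular"
  using a_smooth [of r] by (force simp: regular_def)

text \<open>Twofold continuous differentiability is a local property, so it survives arbitrary
  unions of open sets.\<close>

lemma a_regular: "C_fun 2 regular a"
proof -
  have "isCont (deriv (deriv a)) s" "a differentiable at s" "deriv a differentiable at s"
    if "s \<in> regular" for s
  proof -
    obtain S where "open S" "s \<in> S" "C_fun 2 S a"
      using \<open>s \<in> regular\<close> by (auto simp: regular_def)
    then show "isCont (deriv (deriv a)) s" "a differentiable at s" "deriv a differentiable at s"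
      by (auto simp: numeral_2_eq_2 continuous_on_eq_continuous_at)
  qed
  then show ?thesis
    by (auto simp: numeral_2_eq_2 intro: continuous_at_imp_continuous_on)
qed

lemma deriv_a_regular: "C_fun 1 regular (deriv a)"
  using a_regular by (auto simp: numeral_2_eq_2)

lemma deriv_H_smooth: "C_fun 1 {0<..} (deriv H)"
  using H_smooth by (auto simp: numeral_2_eq_2)

lemma a_H_derivative:
  assumes "r > 0"
  shows "((\<lambda>s. a (H s)) has_real_derivative deriv a (H r) * deriv H r) (at r)"
  using assms H_smooth a_regular H_regular
  by (intro DERIV_chain2 [of a]) (auto simp: numeral_2_eq_2 DERIV_deriv_iff_real_differentiable)

lemma pressure_derivative:
  "r > 0 \<Longrightarrow> (pressure \<gamma> has_real_derivative deriv (pressure \<gamma>) r) (at r)"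
  using C_fun_pressure [of 1 \<gamma>] by (auto simp: DERIV_deriv_iff_real_differentiable)

lemma pressure_pos: "r > 0 \<Longrightarrow> pressure \<gamma> r > 0"
  using \<gamma>_pos by (simp add: pressure_def)

lemma Q_eq_derivative:
  assumes "r > 0"
  shows "(Q_eq \<gamma> a H has_real_derivative
    deriv a (H r) * deriv H r * pressure \<gamma> r + a (H r) * deriv (pressure \<gamma>) r) (at r)"
  using DERIV_mult [OF a_H_derivative [OF assms] pressure_derivative [OF assms]]
  by (simp add: Q_eq_def [abs_def] algebra_simps)

lemma v_eq_Q: "r > 0 \<Longrightarrow> v_eq \<gamma> a H r \<zeta> = \<zeta> / r - Q_eq \<gamma> a H r"
  by (simp add: v_eq_def velocity_def W_eq_def Q_eq_def)

lemma diff_coeff_neg: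
  assumes "r > 0" "deriv (\<lambda>s. a (H s)) r < 0"
  shows "diff_coeff \<gamma> a H r < 0"
  using assms pressure_pos [OF assms(1)] DERIV_imp_deriv [OF a_H_derivative [OF assms(1)]]
  by (simp add: diff_coeff_def mult_neg_pos)

lemma H_differentiable: "r > 0 \<Longrightarrow> H differentiable at r"
  using H_smooth by (auto simp: numeral_2_eq_2)

lemma W_eq_derivative:
  assumes "r > 0"
  shows "(W_eq H has_real_derivative H r + r * deriv H r) (at r)"
proof -
  have "(H has_real_derivative deriv H r) (at r)"
    using H_differentiable [OF assms] by (simp add: DERIV_deriv_iff_real_differentiable)
  from DERIV_mult [OF DERIV_ident this] show ?thesis
    by (simp add: W_eq_def [abs_def] algebra_simps)
qed

end

text \<open>Everything that concerns \<open>\<rho>\<close> and \<open>z\<close> without the relaxed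
  model. It is kept separate so that it can also be interpreted for one fixed pair of fields in the
  matrix form.\<close>

locale bounded_states = constitutive +
  fixes \<Omega> K :: "(real \<times> real) set" and \<rho> z :: field_family
  assumes domain: "open \<Omega>" "K \<subseteq> \<Omega>"
    and C2: "\<forall>\<^sub>F \<epsilon> in at_right 0. C_k_field 2 \<Omega> (\<rho> \<epsilon>)" "\<forall>\<^sub>F \<epsilon> in at_right 0. C_k_field 2 \<Omega> (z \<epsilon>)"
    and pos: "\<forall>\<^sub>F \<epsilon> in at_right 0. \<forall>(t, x)\<in>\<Omega>. \<rho> \<epsilon> t x > 0"
    and bounds: "O_eps_diff 2 K 0 \<rho>" "O_eps_diff 2 K 0 z" "O_eps K 0 (\<lambda>\<epsilon> t x. 1 / \<rho> \<epsilon> t x)"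
begin

lemma X_order_\<rho>: "X_order 2 K 0 \<rho>"
  by (rule X_order_C_k_field [OF domain C2(1) bounds(1)])

lemma X_order_z: "X_order 2 K 0 z"
  by (rule X_order_C_k_field [OF domain C2(2) bounds(2)])

lemma near_pos: "near K (\<lambda>\<epsilon> t y. \<rho> \<epsilon> t y > 0)"
  using near_in_domain [OF domain pos] .

lemma density_range:
  obtains m M where "0 < m" "\<forall>\<^sub>F \<epsilon> in at_right 0. \<forall>(t, x)\<in>K. \<rho> \<epsilon> t x \<in> {m..M}"
proof -
  obtain M where M: "\<forall>\<^sub>F \<epsilon> in at_right 0. \<forall>(t, x)\<in>K. \<bar>\<rho> \<epsilon> t x\<bar> \<le> M"
    using X_order_O_eps [OF X_order_\<rho>] by (auto simp: O_eps_iff)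
  obtain c where c: "\<forall>\<^sub>F \<epsilon> in at_right 0. \<forall>(t, x)\<in>K. \<bar>1 / \<rho> \<epsilon> t x\<bar> \<le> c"
    using bounds(3) by (auto simp: O_eps_iff)
  \<comment> \<open>The bound on \<open>1 / \<rho>\<close> becomes a lower bound on the density;
    \<open>max c 1\<close> keeps that bound positive even when \<open>K\<close> is empty.\<close>
  have "\<forall>\<^sub>F \<epsilon> in at_right 0. \<forall>(t, x)\<in>K. \<rho> \<epsilon> t x \<in> {1 / max c 1..M}"
    using M c near_at [OF near_pos]
  proof eventually_elim
    case (elim \<epsilon>)
    have "1 / max c 1 \<le> \<rho> \<epsilon> t x" if "(t, x) \<in> K" for t x
    proof -
      have "\<rho> \<epsilon> t x > 0" "1 / \<rho> \<epsilon> t x \<le> max c 1" using elim that by force+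
      then show ?thesis by (simp add: field_simps del: max.bounded_iff)
    qed
    then show ?case using elim by force
  qed
  then show ?thesis by (intro that [of "1 / max c 1" M]) auto
qed

lemma X_order_density_fun:
  assumes "C_fun k {0<..} g" "k \<le> 2"
  shows "X_order k K 0 (\<lambda>\<epsilon> t x. g (\<rho> \<epsilon> t x))"
proof -
  obtain m M where m: "0 < m" "\<forall>\<^sub>F \<epsilon> in at_right 0. \<forall>(t, x)\<in>K. \<rho> \<epsilon> t x \<in> {m..M}"
    using density_range .
  then show ?thesis
    using assms(1) X_order_mono [OF X_order_\<rho> assms(2) order_refl]
    by (intro X_order_compose [where C = "{m..M}" and S = "{0<..}" and f = \<rho> and g = g])
      (simp_all add: subset_iff)
qed

text \<open>Taylor's formula runs along the segment from \<open>H \<rho>\<close> to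
  \<open>w / \<rho>\<close>, so membership of \<open>H \<rho>\<close> in \<open>regular\<close> is
  too little: a margin \<open>\<delta>\<close> is required, the same for all points. The compact
  image of the density interval under \<open>H\<close> provides it.\<close>

lemma regular_range:
  obtains C \<delta> where "compact C" "C \<subseteq> regular" "\<delta> > 0"
    "\<forall>\<^sub>F \<epsilon> in at_right 0. \<forall>(t, x)\<in>K. cball (H (\<rho> \<epsilon> t x)) \<delta> \<subseteq> C"
proof -
  obtain m M where m: "0 < m" "\<forall>\<^sub>F \<epsilon> in at_right 0. \<forall>(t, x)\<in>K. \<rho> \<epsilon> t x \<in> {m..M}"
    using density_range .
  define A where "A = H ` {m..M}"
  have A: "compact A" "A \<subseteq> regular"
    unfolding A_def using m(1) C_fun_continuous [OF H_smooth] H_regular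
    by (auto intro!: compact_continuous_image elim: continuous_on_subset)
  obtain \<delta> where \<delta>: "\<delta> > 0" "(\<Union>p\<in>A. cball p \<delta>) \<subseteq> regular"
    using compact_subset_open_imp_cball_epsilon_subset [OF A(1) open_regular A(2)] .
  \<comment> \<open>The union of closed balls is a Minkowski sum of two compact sets, hence
    compact.\<close>
  have "{p + q |p q. p \<in> A \<and> q \<in> cball 0 \<delta>} = (\<Union>p\<in>A. cball p \<delta>)"
  proof (intro set_eqI iffI)
    fix s assume "s \<in> {p + q |p q. p \<in> A \<and> q \<in> cball 0 \<delta>}"
    then obtain p where "p \<in> A" "s \<in> cball p \<delta>" by (auto simp: dist_norm)
    then show "s \<in> (\<Union>p\<in>A. cball p \<delta>)" by blast
  next
    fix s assume "s \<in> (\<Union>p\<in>A. cball p \<delta>)"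
    then obtain p where "p \<in> A" "s - p \<in> cball 0 \<delta>" by (auto simp: dist_norm)
    moreover have "s = p + (s - p)" by simp
    ultimately show "s \<in> {p + q |p q. p \<in> A \<and> q \<in> cball 0 \<delta>}" by blast
  qed
  then have "compact (\<Union>p\<in>A. cball p \<delta>)"
    using compact_sums [OF A(1) compact_cball [of 0 \<delta>]] by simp
  moreover have "\<forall>\<^sub>F \<epsilon> in at_right 0. \<forall>(t, x)\<in>K. cball (H (\<rho> \<epsilon> t x)) \<delta> \<subseteq> (\<Union>p\<in>A. cball p \<delta>)"
  proof -
    have "\<forall>\<^sub>F \<epsilon> in at_right 0. \<forall>(t, x)\<in>K. H (\<rho> \<epsilon> t x) \<in> A"
      using m(2) by eventually_elim (auto simp: A_def split_beta)
    then show ?thesis by eventually_elim blast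
  qed
  ultimately show ?thesis using \<delta> that by blast
qed

lemma X_order_H: "X_order 2 K 0 (\<lambda>\<epsilon> t x. H (\<rho> \<epsilon> t x))"
  by (rule X_order_density_fun [OF H_smooth order_refl])

lemma X_order_regular_fun:
  assumes "C_fun k regular g" "k \<le> 2"
  shows "X_order k K 0 (\<lambda>\<epsilon> t x. g (H (\<rho> \<epsilon> t x)))"
proof -
  obtain C \<delta> where C: "compact C" "C \<subseteq> regular" "\<delta> > 0"
    "\<forall>\<^sub>F \<epsilon> in at_right 0. \<forall>(t, x)\<in>K. cball (H (\<rho> \<epsilon> t x)) \<delta> \<subseteq> C"
    using regular_range .
  have "\<forall>\<^sub>F \<epsilon> in at_right 0. \<forall>(t, x)\<in>K. H (\<rho> \<epsilon> t x) \<in> C"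
    using C(4) by eventually_elim (use C(3) in \<open>auto simp: subset_iff\<close>)
  then show ?thesis
    using assms(1) C(1,2) X_order_mono [OF X_order_H assms(2) order_refl]
    by (intro X_order_compose [where C = C and S = regular and g = g
          and f = "\<lambda>\<epsilon> t x. H (\<rho> \<epsilon> t x)"] open_regular) simp_all
qed

lemma X_order_inverse: "X_order 2 K 0 (\<lambda>\<epsilon> t x. 1 / \<rho> \<epsilon> t x)"
  by (rule X_order_density_fun [OF C_fun_inverse order_refl])

lemma X_order_pressure: "X_order 2 K 0 (\<lambda>\<epsilon> t x. pressure \<gamma> (\<rho> \<epsilon> t x))"
  by (rule X_order_density_fun [OF C_fun_pressure order_refl])

lemma X_order_a_H: "X_order 2 K 0 (\<lambda>\<epsilon> t x. a (H (\<rho> \<epsilon> t x)))"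
  by (rule X_order_regular_fun [OF a_regular order_refl])

lemma X_order_W: "X_order 2 K 0 (\<lambda>\<epsilon> t x. W_eq H (\<rho> \<epsilon> t x))"
  using X_order_mult [OF X_order_\<rho> X_order_H] by (simp add: W_eq_def)

section \<open>Orders of the equilibrium velocity and of the diffusive flux\<close>

definition v0 :: field_family where
  "v0 = (\<lambda>\<epsilon> t x. v_eq \<gamma> a H (\<rho> \<epsilon> t x) (z \<epsilon> t x))"

lemma X_order_v0: "X_order 2 K 0 v0"
proof -
  have "X_order 2 K 0 (\<lambda>\<epsilon> t x. z \<epsilon> t x * (1 / \<rho> \<epsilon> t x) - a (H (\<rho> \<epsilon> t x)) * pressure \<gamma> (\<rho> \<epsilon> t x))"
    using X_order_diff [OF X_order_mult [OF X_order_z X_order_inverse]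
        X_order_mult [OF X_order_a_H X_order_pressure]] by simp
  then show ?thesis
    by (rule X_order_cong [OF near_mono [OF near_pos], rotated]) (simp add: v0_def v_eq_Q Q_eq_def)
qed

lemma X_order_Dx_v0: "X_order 1 K 0 (\<lambda>\<epsilon>. Dx (v0 \<epsilon>))"
  using X_order_v0 by (simp add: numeral_2_eq_2)

lemma X_order_deriv_a_H: "X_order 1 K 0 (\<lambda>\<epsilon> t x. deriv a (H (\<rho> \<epsilon> t x)))"
  by (rule X_order_regular_fun [OF deriv_a_regular]) simp

lemma X_order_deriv_H: "X_order 1 K 0 (\<lambda>\<epsilon> t x. deriv H (\<rho> \<epsilon> t x))"
  by (rule X_order_density_fun [OF deriv_H_smooth]) simp

text \<open>Since \<open>deriv a\<close> and \<open>deriv H\<close> are only once continuously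
  differentiable, one derivative is available here, exactly what the divergence of the diffusive
  flux takes.\<close>

lemma X_order_diff_coeff: "X_order 1 K 0 (\<lambda>\<epsilon> t x. diff_coeff \<gamma> a H (\<rho> \<epsilon> t x))"
  using X_order_mult [OF X_order_mult [OF X_order_mult [OF X_order_deriv_a_H X_order_deriv_H]
        X_order_2D [OF X_order_pressure]] X_order_2D [OF X_order_\<rho>]]
  by (simp add: diff_coeff_def)

lemma X_order_diffusive_flux:
  assumes "X_order 2 K 0 u"
  shows "X_order 1 K 0 (\<lambda>\<epsilon>. diffusive_flux \<gamma> a H (\<rho> \<epsilon>) (z \<epsilon>) (u \<epsilon>))"
  using X_order_mult [OF X_order_mult [OF X_order_2D [OF assms] X_order_diff_coeff] X_order_Dx_v0]
  by (simp add: diffusive_flux_def v0_def)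

end

section \<open>Chapman-Enskog families\<close>

locale chapman_enskog = constitutive +
  fixes \<Omega> K :: "(real \<times> real) set" and \<rho> z w :: field_family
    and G :: "(nat \<Rightarrow> real) \<Rightarrow> (nat \<Rightarrow> real) \<Rightarrow> real"
  assumes family: "chapman_enskog_family \<gamma> a H \<Omega> K \<rho> z w G"

sublocale chapman_enskog \<subseteq> bounded_states
proof
  show "open \<Omega>" "K \<subseteq> \<Omega>" "O_eps_diff 2 K 0 \<rho>" "O_eps_diff 2 K 0 z"
    "O_eps K 0 (\<lambda>\<epsilon> t x. 1 / \<rho> \<epsilon> t x)"
    using family by (simp_all add: chapman_enskog_family_def Let_def)
  have "\<forall>\<^sub>F \<epsilon> in at_right 0. C_k_field 2 \<Omega> (\<rho> \<epsilon>) \<and> C_k_field 2 \<Omega> (z \<epsilon>) \<and> (\<forall>(t, x)\<in>\<Omega>. \<rho> \<epsilon> t x > 0)"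
    using family unfolding chapman_enskog_family_def Let_def by (auto elim!: eventually_mono)
  then show "\<forall>\<^sub>F \<epsilon> in at_right 0. C_k_field 2 \<Omega> (\<rho> \<epsilon>)" "\<forall>\<^sub>F \<epsilon> in at_right 0. C_k_field 2 \<Omega> (z \<epsilon>)"
    "\<forall>\<^sub>F \<epsilon> in at_right 0. \<forall>(t, x)\<in>\<Omega>. \<rho> \<epsilon> t x > 0"
    by (auto elim!: eventually_mono)
qed

context chapman_enskog
begin

definition w1 :: field_family where
  "w1 = (\<lambda>\<epsilon> t x. G (x_jet (\<rho> \<epsilon>) t x) (x_jet (z \<epsilon>) t x))"

definition v :: field_family where
  "v = (\<lambda>\<epsilon> t x. velocity \<gamma> a (\<rho> \<epsilon> t x) (z \<epsilon> t x) (w \<epsilon> t x))"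

definition h :: field_family where
  "h = (\<lambda>\<epsilon> t x. w \<epsilon> t x / \<rho> \<epsilon> t x)"

definition e :: field_family where
  "e = (\<lambda>\<epsilon> t x. w \<epsilon> t x - W_eq H (\<rho> \<epsilon> t x))"

definition e2 :: field_family where
  "e2 = (\<lambda>\<epsilon> t x. w \<epsilon> t x - (W_eq H (\<rho> \<epsilon> t x) + \<epsilon> * w1 \<epsilon> t x))"

definition d :: field_family where
  "d = (\<lambda>\<epsilon> t x. v \<epsilon> t x - v0 \<epsilon> t x)"

section \<open>Regularity and bounds supplied by the family\<close>

lemma C2_w: "\<forall>\<^sub>F \<epsilon> in at_right 0. C_k_field 2 \<Omega> (w \<epsilon>)"
  using family unfolding chapman_enskog_family_def Let_def by (auto elim!: eventually_mono)

lemma C1_w1: "\<forall>\<^sub>F \<epsilon> in at_right 0. C_k_field 1 \<Omega> (w1 \<epsilon>)"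
  using family unfolding chapman_enskog_family_def Let_def w1_def by (auto elim!: eventually_mono)

lemma bounds_w1: "O_eps_diff 1 K 0 w1"
  using family unfolding chapman_enskog_family_def Let_def w1_def by auto

lemma bounds_e2: "O_eps_diff 1 K 2 e2"
  using family unfolding chapman_enskog_family_def Let_def w1_def e2_def by auto

lemma near_relaxed:
  "near K (\<lambda>\<epsilon> t y. Dt (\<rho> \<epsilon>) t y + Dx (\<lambda>t x. \<rho> \<epsilon> t x * v \<epsilon> t x) t y = 0 \<and>
    Dt (z \<epsilon>) t y + Dx (\<lambda>t x. z \<epsilon> t x * v \<epsilon> t x) t y = 0 \<and>
    Dt (w \<epsilon>) t y + Dx (\<lambda>t x. w \<epsilon> t x * v \<epsilon> t x) t y = - (e \<epsilon> t y / \<epsilon>))"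
proof (rule near_in_domain [OF domain])
  have "\<forall>\<^sub>F \<epsilon> in at_right 0. relaxed_model \<gamma> a H \<Omega> \<epsilon> (\<rho> \<epsilon>) (z \<epsilon>) (w \<epsilon>)"
    using family unfolding chapman_enskog_family_def Let_def by (auto elim!: eventually_mono)
  then show "\<forall>\<^sub>F \<epsilon> in at_right 0. \<forall>(t, x)\<in>\<Omega>.
    Dt (\<rho> \<epsilon>) t x + Dx (\<lambda>t x. \<rho> \<epsilon> t x * v \<epsilon> t x) t x = 0 \<and>
    Dt (z \<epsilon>) t x + Dx (\<lambda>t x. z \<epsilon> t x * v \<epsilon> t x) t x = 0 \<and>
    Dt (w \<epsilon>) t x + Dx (\<lambda>t x. w \<epsilon> t x * v \<epsilon> t x) t x = - (e \<epsilon> t x / \<epsilon>)"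
    by (simp add: relaxed_model_def Let_def v_def e_def)
qed

lemma near_smooth:
  "near K (\<lambda>\<epsilon> t y. \<rho> \<epsilon> t y > 0 \<and>
    (\<lambda>s. \<rho> \<epsilon> s y) differentiable at t \<and> \<rho> \<epsilon> t differentiable at y \<and>
    (\<lambda>s. w \<epsilon> s y) differentiable at t \<and> w \<epsilon> t differentiable at y \<and>
    (\<lambda>s. w1 \<epsilon> s y) differentiable at t \<and> w1 \<epsilon> t differentiable at y)"
  using near_conj [OF near_pos near_conj [OF
      near_C_k_field [OF domain C2(1) [unfolded numeral_2_eq_2]] near_conj [OF
      near_C_k_field [OF domain C2_w [unfolded numeral_2_eq_2]]
      near_C_k_field [OF domain C1_w1 [unfolded One_nat_def]]]]]
  by (rule near_mono) simp

lemma near_W: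
  "near K (\<lambda>\<epsilon> t y. (\<lambda>s. W_eq H (\<rho> \<epsilon> s y)) differentiable at t \<and>
    (\<lambda>s. W_eq H (\<rho> \<epsilon> t s)) differentiable at y \<and>
    Dt (\<lambda>t x. W_eq H (\<rho> \<epsilon> t x)) t y = (H (\<rho> \<epsilon> t y) + \<rho> \<epsilon> t y * deriv H (\<rho> \<epsilon> t y)) * Dt (\<rho> \<epsilon>) t y \<and>
    Dx (\<lambda>t x. W_eq H (\<rho> \<epsilon> t x)) t y = (H (\<rho> \<epsilon> t y) + \<rho> \<epsilon> t y * deriv H (\<rho> \<epsilon> t y)) * Dx (\<rho> \<epsilon>) t y)"
proof (rule near_mono [OF near_smooth], elim conjE, intro conjI)
  fix \<epsilon> t y
  assume s: "\<rho> \<epsilon> t y > 0" "(\<lambda>s. \<rho> \<epsilon> s y) differentiable at t" "\<rho> \<epsilon> t differentiable at y"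
  note D = W_eq_derivative [OF s(1)]
  have W: "W_eq H differentiable at (\<rho> \<epsilon> t y)"
    using D by (auto simp: real_differentiable_def)
  show "(\<lambda>s. W_eq H (\<rho> \<epsilon> s y)) differentiable at t" "(\<lambda>s. W_eq H (\<rho> \<epsilon> t s)) differentiable at y"
    by (rule differentiable_compose_real [OF s(2) W], rule differentiable_compose_real [OF s(3) W])
  show "Dt (\<lambda>t x. W_eq H (\<rho> \<epsilon> t x)) t y = (H (\<rho> \<epsilon> t y) + \<rho> \<epsilon> t y * deriv H (\<rho> \<epsilon> t y)) * Dt (\<rho> \<epsilon>) t y"
    "Dx (\<lambda>t x. W_eq H (\<rho> \<epsilon> t x)) t y = (H (\<rho> \<epsilon> t y) + \<rho> \<epsilon> t y * deriv H (\<rho> \<epsilon> t y)) * Dx (\<rho> \<epsilon>) t y"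
    using Dt_compose [of "\<rho> \<epsilon>", OF s(2) W] Dx_compose [of "\<rho> \<epsilon>", OF s(3) W] DERIV_imp_deriv [OF D] by simp_all
qed

lemma X_order_w1: "X_order 1 K 0 w1"
  by (rule X_order_C_k_field [OF domain C1_w1 bounds_w1])

lemma X_order_e2: "X_order 1 K 2 e2"
proof -
  have "near K (\<lambda>\<epsilon> t y. e2 \<epsilon> t differentiable at y)"
    by (rule near_mono [OF near_conj [OF near_smooth near_W]]) (auto simp: e2_def)
  then show ?thesis using bounds_e2 by simp
qed

lemma e_e2: "e = (\<lambda>\<epsilon> t x. e2 \<epsilon> t x + \<epsilon> * w1 \<epsilon> t x)"
  by (simp add: e_def e2_def)

text \<open>The expansion provides the size of \<open>e\<close>; its leading coefficient will be
  read off from the relaxed equation in \<open>near_e\<close>.\<close>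

lemma X_order_e: "X_order 1 K 1 e"
  unfolding e_e2
  using X_order_add [OF X_order_mono [OF X_order_e2, of 1 1]
      X_order_mult [OF X_order_parameter X_order_w1, unfolded add_0_right]] by simp

lemma O_eps_Dt_e: "O_eps K 1 (\<lambda>\<epsilon>. Dt (e \<epsilon>))"
proof -
  have "near K (\<lambda>\<epsilon> t y. Dt (e2 \<epsilon>) t y + \<epsilon> * Dt (w1 \<epsilon>) t y = Dt (e \<epsilon>) t y)"
  proof (rule near_mono [OF near_conj [OF near_smooth near_W]], elim conjE)
    fix \<epsilon> t y
    assume s: "(\<lambda>s. w \<epsilon> s y) differentiable at t" "(\<lambda>s. w1 \<epsilon> s y) differentiable at t"
      "(\<lambda>s. W_eq H (\<rho> \<epsilon> s y)) differentiable at t"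
    then have "(\<lambda>s. e2 \<epsilon> s y) differentiable at t" by (simp add: e2_def)
    then show "Dt (e2 \<epsilon>) t y + \<epsilon> * Dt (w1 \<epsilon>) t y = Dt (e \<epsilon>) t y"
      using s by (simp add: e_e2 Dt_add Dt_cmult)
  qed
  moreover have "O_eps K 1 (\<lambda>\<epsilon> t x. Dt (e2 \<epsilon>) t x + \<epsilon> * Dt (w1 \<epsilon>) t x)"
  proof (rule O_eps_add)
    show "O_eps K 1 (\<lambda>\<epsilon>. Dt (e2 \<epsilon>))"
      using bounds_e2 by (auto intro: O_eps_mono)
    show "O_eps K 1 (\<lambda>\<epsilon> t x. \<epsilon> * Dt (w1 \<epsilon>) t x)"
      using O_eps_mult [OF O_eps_parameter, of K 0 "\<lambda>\<epsilon>. Dt (w1 \<epsilon>)"] bounds_w1 by simp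
  qed
  ultimately show ?thesis by (rule X_order_cong [where k = 0, simplified])
qed

text \<open>\<open>h - H \<rho> = e / \<rho>\<close>. The number \<open>k\<close> stays open because
  \<open>e\<close> is first controlled with one spatial derivative and, under the convention, with
  two.\<close>

lemma X_order_h:
  assumes "X_order k K 1 e" "k \<le> 2"
  shows "X_order k K 1 (\<lambda>\<epsilon> t x. h \<epsilon> t x - H (\<rho> \<epsilon> t x))" and "X_order k K 0 h"
proof -
  have "X_order k K (1 + 0) (\<lambda>\<epsilon> t x. e \<epsilon> t x * (1 / \<rho> \<epsilon> t x))"
    using X_order_mult [OF assms(1) X_order_mono [OF X_order_inverse assms(2) order_refl]] .
  then show *: "X_order k K 1 (\<lambda>\<epsilon> t x. h \<epsilon> t x - H (\<rho> \<epsilon> t x))"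
    unfolding add_0_right
    by (rule X_order_cong [OF near_mono [OF near_pos], rotated])
      (simp add: e_def h_def W_eq_def field_simps)
  show "X_order k K 0 h"
    using X_order_add [OF X_order_mono [OF * order_refl, of 0] X_order_mono [OF X_order_H assms(2), of 0]]
    by simp
qed

text \<open>The distance from \<open>H \<rho>\<close> to \<open>h\<close> is at most a multiple of
  \<open>\<epsilon>\<close>, hence eventually below the margin \<open>\<delta>\<close>, and a ball
  contains the segment from its centre to any of its points.\<close>

lemma segment_range:
  obtains C where "compact C" "C \<subseteq> regular"
    "\<forall>\<^sub>F \<epsilon> in at_right 0. \<forall>(t, x)\<in>K. closed_segment (H (\<rho> \<epsilon> t x)) (h \<epsilon> t x) \<subseteq> C"
proof -
  obtain C \<delta> where C: "compact C" "C \<subseteq> regular" "\<delta> > 0"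
    "\<forall>\<^sub>F \<epsilon> in at_right 0. \<forall>(t, x)\<in>K. cball (H (\<rho> \<epsilon> t x)) \<delta> \<subseteq> C"
    using regular_range .
  obtain c where c: "\<forall>\<^sub>F \<epsilon> in at_right 0. \<forall>(t, x)\<in>K. \<bar>h \<epsilon> t x - H (\<rho> \<epsilon> t x)\<bar> \<le> c * \<epsilon> ^ 1"
    using X_order_O_eps [OF X_order_h(1) [OF X_order_e]] unfolding O_eps_iff by auto
  have "((\<lambda>\<epsilon>. c * \<epsilon> ^ 1) \<longlongrightarrow> c * 0 ^ 1) (at_right (0::real))"
    by (intro tendsto_intros)
  then have "\<forall>\<^sub>F \<epsilon> in at_right 0. c * \<epsilon> ^ 1 < \<delta>"
    using C(3) by (auto dest: order_tendstoD(2))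
  with c C(4) have "\<forall>\<^sub>F \<epsilon> in at_right 0. \<forall>(t, x)\<in>K. closed_segment (H (\<rho> \<epsilon> t x)) (h \<epsilon> t x) \<subseteq> C"
  proof eventually_elim
    case (elim \<epsilon>)
    have "closed_segment (H (\<rho> \<epsilon> t x)) (h \<epsilon> t x) \<subseteq> C" if "(t, x) \<in> K" for t x
    proof -
      have "\<bar>h \<epsilon> t x - H (\<rho> \<epsilon> t x)\<bar> \<le> \<delta>" "cball (H (\<rho> \<epsilon> t x)) \<delta> \<subseteq> C"
        using elim that by force+
      moreover have "closed_segment (H (\<rho> \<epsilon> t x)) (h \<epsilon> t x) \<subseteq> cball (H (\<rho> \<epsilon> t x)) \<delta>"
        using calculation(1) C(3)
        by (intro closed_segment_subset) (auto simp: dist_real_def abs_minus_commute)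
      ultimately show ?thesis by blast
    qed
    then show ?case by blast
  qed
  then show ?thesis using that C(1,2) by blast
qed

lemma X_order_h_fun:
  assumes "C_fun k regular g" "X_order k K 0 h"
  shows "X_order k K 0 (\<lambda>\<epsilon> t x. g (h \<epsilon> t x))"
proof -
  obtain C where C: "compact C" "C \<subseteq> regular"
    "\<forall>\<^sub>F \<epsilon> in at_right 0. \<forall>(t, x)\<in>K. closed_segment (H (\<rho> \<epsilon> t x)) (h \<epsilon> t x) \<subseteq> C"
    using segment_range .
  have "\<forall>\<^sub>F \<epsilon> in at_right 0. \<forall>(t, x)\<in>K. h \<epsilon> t x \<in> C"
    using C(3) by eventually_elim (auto simp: subset_iff)
  then show ?thesis
    using X_order_compose [OF open_regular C(1,2) _ assms] by blast
qed

lemma O_eps_increment: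
  assumes "C_fun 1 regular g"
  shows "O_eps K 1 (\<lambda>\<epsilon> t x. g (h \<epsilon> t x) - g (H (\<rho> \<epsilon> t x)))"
proof -
  obtain C where C: "compact C" "C \<subseteq> regular"
    "\<forall>\<^sub>F \<epsilon> in at_right 0. \<forall>(t, x)\<in>K. closed_segment (H (\<rho> \<epsilon> t x)) (h \<epsilon> t x) \<subseteq> C"
    using segment_range .
  have "continuous_on C (deriv g)"
    using assms C(2) by (auto elim: continuous_on_subset)
  then obtain B where B: "\<And>s. s \<in> C \<Longrightarrow> \<bar>deriv g s\<bar> \<le> B"
    using compact_bound [OF C(1)] by blast
  have "\<forall>\<^sub>F \<epsilon> in at_right 0. \<forall>(t, x)\<in>K.
      \<bar>g (h \<epsilon> t x) - g (H (\<rho> \<epsilon> t x))\<bar> \<le> \<bar>B * (h \<epsilon> t x - H (\<rho> \<epsilon> t x))\<bar>"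
    using C(3)
  proof eventually_elim
    case (elim \<epsilon>)
    have "\<bar>g (h \<epsilon> t x) - g (H (\<rho> \<epsilon> t x))\<bar> \<le> B * \<bar>h \<epsilon> t x - H (\<rho> \<epsilon> t x)\<bar>" if "(t, x) \<in> K" for t x
      using elim that assms C(2) B by (intro increment_bound [of _ _ C]) auto
    then show ?case by (force simp: abs_mult intro: order_trans mult_right_mono)
  qed
  moreover have "O_eps K (0 + 1) (\<lambda>\<epsilon> t x. B * (h \<epsilon> t x - H (\<rho> \<epsilon> t x)))"
    by (rule O_eps_mult [OF O_eps_const X_order_O_eps [OF X_order_h(1) [OF X_order_e]]]) simp
  ultimately show ?thesis using O_eps_dominated [of K 1] by simp
qed

lemma O_eps_second_increment:
  "O_eps K 2 (\<lambda>\<epsilon> t x. a (h \<epsilon> t x) - a (H (\<rho> \<epsilon> t x)) - deriv a (H (\<rho> \<epsilon> t x)) * (h \<epsilon> t x - H (\<rho> \<epsilon> t x)))"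
proof -
  obtain C where C: "compact C" "C \<subseteq> regular"
    "\<forall>\<^sub>F \<epsilon> in at_right 0. \<forall>(t, x)\<in>K. closed_segment (H (\<rho> \<epsilon> t x)) (h \<epsilon> t x) \<subseteq> C"
    using segment_range .
  have a: "\<And>s. s \<in> regular \<Longrightarrow> a differentiable at s" "\<And>s. s \<in> regular \<Longrightarrow> deriv a differentiable at s"
    "continuous_on regular (deriv (deriv a))"
    using a_regular by (auto simp: numeral_2_eq_2)
  have "continuous_on C (deriv (deriv a))"
    using a(3) C(2) by (rule continuous_on_subset)
  then obtain B where B: "\<And>s. s \<in> C \<Longrightarrow> \<bar>deriv (deriv a) s\<bar> \<le> B"
    using compact_bound [OF C(1)] by blast
  have "\<forall>\<^sub>F \<epsilon> in at_right 0. \<forall>(t, x)\<in>K.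
      \<bar>a (h \<epsilon> t x) - a (H (\<rho> \<epsilon> t x)) - deriv a (H (\<rho> \<epsilon> t x)) * (h \<epsilon> t x - H (\<rho> \<epsilon> t x))\<bar>
      \<le> \<bar>B * ((h \<epsilon> t x - H (\<rho> \<epsilon> t x)) * (h \<epsilon> t x - H (\<rho> \<epsilon> t x)))\<bar>"
    using C(3)
  proof eventually_elim
    case (elim \<epsilon>)
    have "\<bar>a (h \<epsilon> t x) - a (H (\<rho> \<epsilon> t x)) - deriv a (H (\<rho> \<epsilon> t x)) * (h \<epsilon> t x - H (\<rho> \<epsilon> t x))\<bar>
      \<le> B * (h \<epsilon> t x - H (\<rho> \<epsilon> t x))\<^sup>2" if "(t, x) \<in> K" for t x
      using elim that a(1,2) C(2) B by (intro taylor_remainder_bound [of _ _ C]) auto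
    then show ?case by (auto simp: power2_eq_square intro: order_trans [OF _ abs_ge_self])
  qed
  moreover have "O_eps K (0 + (1 + 1)) (\<lambda>\<epsilon> t x. B * ((h \<epsilon> t x - H (\<rho> \<epsilon> t x)) * (h \<epsilon> t x - H (\<rho> \<epsilon> t x))))"
    by (intro O_eps_mult O_eps_const X_order_O_eps [OF X_order_h(1) [OF X_order_e]]) simp_all
  ultimately show ?thesis using O_eps_dominated [of K 2] by (simp add: numeral_2_eq_2)
qed

lemma near_d:
  "near K (\<lambda>\<epsilon> t y. d \<epsilon> t y = - ((a (h \<epsilon> t y) - a (H (\<rho> \<epsilon> t y))) * pressure \<gamma> (\<rho> \<epsilon> t y)))"
  by (rule near_mono [OF near_pos])
    (simp add: d_def v_def v0_def v_eq_def velocity_def W_eq_def h_def algebra_simps)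

text \<open>On \<open>K\<close> the values of \<open>h\<close> lie in \<open>regular\<close> by the
  segment estimate; continuity extends this to neighbourhoods, which is where the chain rule for
  \<open>a\<close> is applied.\<close>

lemma near_in_regular: "near K (\<lambda>\<epsilon> t y. h \<epsilon> t y \<in> regular \<and> H (\<rho> \<epsilon> t y) \<in> regular)"
proof -
  obtain C where C: "compact C" "C \<subseteq> regular"
    "\<forall>\<^sub>F \<epsilon> in at_right 0. \<forall>(t, x)\<in>K. closed_segment (H (\<rho> \<epsilon> t x)) (h \<epsilon> t x) \<subseteq> C"
    using segment_range .
  have "\<forall>\<^sub>F \<epsilon> in at_right 0. \<forall>(t, x)\<in>K. h \<epsilon> t x \<in> regular"
    using C(3) by eventually_elim (use C(2) in \<open>auto simp: subset_iff\<close>)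
  from near_in_open [OF open_regular X_order_1_differentiable [OF X_order_h(2) [OF X_order_e]] this]
  have "near K (\<lambda>\<epsilon> t y. h \<epsilon> t y \<in> regular)" by simp
  then show ?thesis
    by (rule near_mono [OF near_conj [OF near_pos]]) (simp add: H_regular)
qed

text \<open>The derivative of \<open>a h - a (H \<rho>)\<close> is regrouped as \<open>a' h * Dx (h
  - H \<rho>) + (a' h - a' (H \<rho>)) * Dx (H \<rho>)\<close>. The first term is small because
  \<open>h - H \<rho>\<close> keeps its order under one derivative, the second by the mean value
  inequality for \<open>deriv a\<close>. This uses the full regularity of \<open>a\<close>, so a
  rate for a second derivative is out of reach here.\<close>

lemma X_order_d: "X_order 1 K 1 d"
proof -
  have h: "X_order 1 K 0 h" "X_order 1 K 1 (\<lambda>\<epsilon> t x. h \<epsilon> t x - H (\<rho> \<epsilon> t x))"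
    using X_order_h [OF X_order_e] by simp_all
  have smooth: "near K (\<lambda>\<epsilon> t y. h \<epsilon> t differentiable at y \<and> (\<lambda>s. H (\<rho> \<epsilon> t s)) differentiable at y \<and>
      a differentiable at (h \<epsilon> t y) \<and> a differentiable at (H (\<rho> \<epsilon> t y)))"
    using near_conj [OF near_in_regular near_conj [OF X_order_1_differentiable [OF h(1)]
          X_order_2_differentiable [OF X_order_H]]] a_regular
    by (auto simp: numeral_2_eq_2 elim!: near_mono)
  have "X_order 1 K 1 (\<lambda>\<epsilon> t x. a (h \<epsilon> t x) - a (H (\<rho> \<epsilon> t x)))"
  proof -
    have diff: "near K (\<lambda>\<epsilon> t y. (\<lambda>s. a (h \<epsilon> t s) - a (H (\<rho> \<epsilon> t s))) differentiable at y)"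
      by (rule near_mono [OF smooth]) (auto intro!: differentiable_diff differentiable_compose_real [of _ _ a])
    have "near K (\<lambda>\<epsilon> t y.
        deriv a (h \<epsilon> t y) * Dx (\<lambda>t x. h \<epsilon> t x - H (\<rho> \<epsilon> t x)) t y
          + (deriv a (h \<epsilon> t y) - deriv a (H (\<rho> \<epsilon> t y))) * Dx (\<lambda>t x. H (\<rho> \<epsilon> t x)) t y
        = Dx (\<lambda>t x. a (h \<epsilon> t x) - a (H (\<rho> \<epsilon> t x))) t y)"
    proof (rule near_mono [OF smooth], elim conjE)
      fix \<epsilon> t y
      assume s: "h \<epsilon> t differentiable at y" "(\<lambda>s. H (\<rho> \<epsilon> t s)) differentiable at y"
        "a differentiable at (h \<epsilon> t y)" "a differentiable at (H (\<rho> \<epsilon> t y))"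
      have "Dx (\<lambda>t x. a (h \<epsilon> t x) - a (H (\<rho> \<epsilon> t x))) t y
          = Dx (\<lambda>t x. a (h \<epsilon> t x)) t y - Dx (\<lambda>t x. a (H (\<rho> \<epsilon> t x))) t y"
        using s by (intro Dx_diff) (auto intro: differentiable_compose_real [of _ _ a])
      also have "\<dots> = deriv a (h \<epsilon> t y) * Dx (h \<epsilon>) t y
          - deriv a (H (\<rho> \<epsilon> t y)) * Dx (\<lambda>t x. H (\<rho> \<epsilon> t x)) t y"
        using s Dx_compose [of "h \<epsilon>" t y a] Dx_compose [of "\<lambda>t x. H (\<rho> \<epsilon> t x)" t y a] by simp
      finally show "deriv a (h \<epsilon> t y) * Dx (\<lambda>t x. h \<epsilon> t x - H (\<rho> \<epsilon> t x)) t y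
          + (deriv a (h \<epsilon> t y) - deriv a (H (\<rho> \<epsilon> t y))) * Dx (\<lambda>t x. H (\<rho> \<epsilon> t x)) t y
        = Dx (\<lambda>t x. a (h \<epsilon> t x) - a (H (\<rho> \<epsilon> t x))) t y"
        using s by (simp add: Dx_diff algebra_simps)
    qed
    moreover have "O_eps K 1 (\<lambda>\<epsilon> t x.
        deriv a (h \<epsilon> t x) * Dx (\<lambda>t x. h \<epsilon> t x - H (\<rho> \<epsilon> t x)) t x
          + (deriv a (h \<epsilon> t x) - deriv a (H (\<rho> \<epsilon> t x))) * Dx (\<lambda>t x. H (\<rho> \<epsilon> t x)) t x)"
    proof (rule O_eps_add)
      show "O_eps K 1 (\<lambda>\<epsilon> t x. deriv a (h \<epsilon> t x) * Dx (\<lambda>t x. h \<epsilon> t x - H (\<rho> \<epsilon> t x)) t x)"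
        using O_eps_mult [OF X_order_O_eps [OF X_order_h_fun [OF deriv_a_regular h(1)]] X_order_1_Dx [OF h(2)]]
        by simp
      show "O_eps K 1 (\<lambda>\<epsilon> t x. (deriv a (h \<epsilon> t x) - deriv a (H (\<rho> \<epsilon> t x))) * Dx (\<lambda>t x. H (\<rho> \<epsilon> t x)) t x)"
        using O_eps_mult [OF O_eps_increment [OF deriv_a_regular] X_order_1_Dx [OF X_order_2D [OF X_order_H]]]
        by simp
    qed
    ultimately have "O_eps K 1 (\<lambda>\<epsilon>. Dx (\<lambda>t x. a (h \<epsilon> t x) - a (H (\<rho> \<epsilon> t x))))"
      by (rule X_order_cong [where k = 0, simplified])
    moreover have "O_eps K 1 (\<lambda>\<epsilon> t x. a (h \<epsilon> t x) - a (H (\<rho> \<epsilon> t x)))"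
      by (rule O_eps_increment [OF C_fun_SucD [OF a_regular [unfolded numeral_2_eq_2], folded One_nat_def]])
    ultimately show ?thesis
      using diff by simp
  qed
  from X_order_minus [OF X_order_mult [OF this X_order_2D [OF X_order_pressure]]]
  have "X_order 1 K 1 (\<lambda>\<epsilon> t x. - ((a (h \<epsilon> t x) - a (H (\<rho> \<epsilon> t x))) * pressure \<gamma> (\<rho> \<epsilon> t x)))"
    by (simp only: add_0_right)
  then show ?thesis
    by (rule X_order_cong [OF near_mono [OF near_d], rotated]) simp
qed

section \<open>The exact identity for the deviation from equilibrium\<close>

lemma v_eq_d: "v = (\<lambda>\<epsilon> t x. v0 \<epsilon> t x + d \<epsilon> t x)"
  by (simp add: d_def)

lemma X_order_v: "X_order k K 1 d \<Longrightarrow> k \<le> 2 \<Longrightarrow> X_order k K 0 v"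
  unfolding v_eq_d
  by (rule X_order_add [OF X_order_mono [OF X_order_v0] X_order_mono [OF _ order_refl]]) simp_all

definition E :: field_family where
  "E = (\<lambda>\<epsilon> t x. \<rho> \<epsilon> t x * \<rho> \<epsilon> t x * deriv H (\<rho> \<epsilon> t x) * Dx (d \<epsilon>) t x
     - Dt (e \<epsilon>) t x - v \<epsilon> t x * Dx (e \<epsilon>) t x - e \<epsilon> t x * Dx (v \<epsilon>) t x)"

lemma near_e:
  "near K (\<lambda>\<epsilon> t y. e \<epsilon> t y =
     \<epsilon> * (\<rho> \<epsilon> t y * \<rho> \<epsilon> t y * deriv H (\<rho> \<epsilon> t y) * Dx (v0 \<epsilon>) t y + E \<epsilon> t y))"
proof (rule near_mono [OF near_conj [OF near_conj [OF near_conj [OF near_smooth near_W]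
        near_conj [OF near_relaxed near_positive_parameter]]
        near_conj [OF X_order_1_differentiable [OF X_order_d] X_order_2_differentiable [OF X_order_v0]]]],
    elim conjE)
  fix \<epsilon> t y
  assume s: "(\<lambda>s. \<rho> \<epsilon> s y) differentiable at t" "\<rho> \<epsilon> t differentiable at y"
    "(\<lambda>s. w \<epsilon> s y) differentiable at t" "w \<epsilon> t differentiable at y"
    "(\<lambda>s. W_eq H (\<rho> \<epsilon> s y)) differentiable at t" "(\<lambda>s. W_eq H (\<rho> \<epsilon> t s)) differentiable at y"
    and W: "Dt (\<lambda>t x. W_eq H (\<rho> \<epsilon> t x)) t y = (H (\<rho> \<epsilon> t y) + \<rho> \<epsilon> t y * deriv H (\<rho> \<epsilon> t y)) * Dt (\<rho> \<epsilon>) t y"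
      "Dx (\<lambda>t x. W_eq H (\<rho> \<epsilon> t x)) t y = (H (\<rho> \<epsilon> t y) + \<rho> \<epsilon> t y * deriv H (\<rho> \<epsilon> t y)) * Dx (\<rho> \<epsilon>) t y"
    and eqs: "Dt (\<rho> \<epsilon>) t y + Dx (\<lambda>t x. \<rho> \<epsilon> t x * v \<epsilon> t x) t y = 0"
      "Dt (w \<epsilon>) t y + Dx (\<lambda>t x. w \<epsilon> t x * v \<epsilon> t x) t y = - (e \<epsilon> t y / \<epsilon>)"
    and "\<epsilon> > 0"
    and d: "d \<epsilon> t differentiable at y" "v0 \<epsilon> t differentiable at y"
  have v: "v \<epsilon> t differentiable at y" "Dx (v \<epsilon>) t y = Dx (v0 \<epsilon>) t y + Dx (d \<epsilon>) t y"
    using d by (simp_all add: v_eq_d Dx_add)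
  have "Dt (e \<epsilon>) t y = Dt (w \<epsilon>) t y - Dt (\<lambda>t x. W_eq H (\<rho> \<epsilon> t x)) t y"
    "Dx (e \<epsilon>) t y = Dx (w \<epsilon>) t y - Dx (\<lambda>t x. W_eq H (\<rho> \<epsilon> t x)) t y"
    using s by (simp_all add: e_def Dt_diff Dx_diff)
  with W have w: "Dt (w \<epsilon>) t y = Dt (e \<epsilon>) t y + (H (\<rho> \<epsilon> t y) + \<rho> \<epsilon> t y * deriv H (\<rho> \<epsilon> t y)) * Dt (\<rho> \<epsilon>) t y"
    "Dx (w \<epsilon>) t y = Dx (e \<epsilon>) t y + (H (\<rho> \<epsilon> t y) + \<rho> \<epsilon> t y * deriv H (\<rho> \<epsilon> t y)) * Dx (\<rho> \<epsilon>) t y"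
    by simp_all
  have r: "Dt (\<rho> \<epsilon>) t y = - (Dx (\<rho> \<epsilon>) t y * v \<epsilon> t y + \<rho> \<epsilon> t y * Dx (v \<epsilon>) t y)"
    using eqs(1) s v by (simp add: Dx_mult)
  have W_e: "w \<epsilon> t y = e \<epsilon> t y + \<rho> \<epsilon> t y * H (\<rho> \<epsilon> t y)"
    by (simp add: e_def W_eq_def)
  have "e \<epsilon> t y = - \<epsilon> * (Dt (w \<epsilon>) t y + (Dx (w \<epsilon>) t y * v \<epsilon> t y + w \<epsilon> t y * Dx (v \<epsilon>) t y))"
    using eqs(2) s v \<open>\<epsilon> > 0\<close> by (simp add: Dx_mult field_simps)
  \<comment> \<open>Mass conservation gives
    \<open>\<rho>\<^sub>t + v \<rho>\<^sub>x = - \<rho> v\<^sub>x\<close>, so the equilibrium part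
    of the left side is \<open>- (H + \<rho> H') \<rho> v\<^sub>x + \<rho> H v\<^sub>x = -
    \<rho>\<^sup>2 H' v\<^sub>x\<close>: the terms in \<open>H\<close> cancel. Splitting
    \<open>v\<^sub>x\<close> into \<open>v0\<^sub>x + d\<^sub>x\<close> moves the small part into
    \<open>E\<close>.\<close>
  also have "\<dots> = \<epsilon> * (\<rho> \<epsilon> t y * \<rho> \<epsilon> t y * deriv H (\<rho> \<epsilon> t y) * Dx (v0 \<epsilon>) t y + E \<epsilon> t y)"
    unfolding w r E_def v(2) W_e by (simp add: algebra_simps)
  finally show "e \<epsilon> t y =
     \<epsilon> * (\<rho> \<epsilon> t y * \<rho> \<epsilon> t y * deriv H (\<rho> \<epsilon> t y) * Dx (v0 \<epsilon>) t y + E \<epsilon> t y)" .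
qed

text \<open>Stated for general \<open>k\<close> because it is used twice: with \<open>k = 0\<close>
  from the family alone, and with \<open>k = 1\<close> once the convention controls a further
  derivative of \<open>d\<close>, \<open>e\<close> and \<open>Dt e\<close>.\<close>

lemma X_order_E:
  assumes "X_order (Suc k) K 1 d" "X_order (Suc k) K 1 e" "X_order k K 1 (\<lambda>\<epsilon>. Dt (e \<epsilon>))" "k \<le> 1"
  shows "X_order k K 1 E"
proof -
  have *: "X_order k K 0 v" "X_order k K 0 (\<lambda>\<epsilon>. Dx (v \<epsilon>))"
    using X_order_v [OF assms(1)] \<open>k \<le> 1\<close> X_order_SucD [of k K 0 v] by auto
  have "X_order k K 0 (\<lambda>\<epsilon> t x. \<rho> \<epsilon> t x * \<rho> \<epsilon> t x * deriv H (\<rho> \<epsilon> t x))"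
    using X_order_mult [OF X_order_mult [OF X_order_2D [OF X_order_\<rho>] X_order_2D [OF X_order_\<rho>]] X_order_deriv_H]
    by (rule X_order_mono) (use \<open>k \<le> 1\<close> in simp_all)
  from X_order_mult [OF this, of 1 "\<lambda>\<epsilon>. Dx (d \<epsilon>)"]
  have "X_order k K 1 (\<lambda>\<epsilon> t x. \<rho> \<epsilon> t x * \<rho> \<epsilon> t x * deriv H (\<rho> \<epsilon> t x) * Dx (d \<epsilon>) t x)"
    using assms(1) by simp
  moreover have "X_order k K 1 (\<lambda>\<epsilon> t x. v \<epsilon> t x * Dx (e \<epsilon>) t x)"
    using X_order_mult [OF *(1), of 1 "\<lambda>\<epsilon>. Dx (e \<epsilon>)"] assms(2) by simp
  moreover have "X_order k K 1 (\<lambda>\<epsilon> t x. e \<epsilon> t x * Dx (v \<epsilon>) t x)"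
    using X_order_mult [OF X_order_SucD [OF assms(2)] *(2)] by simp
  ultimately show ?thesis
    unfolding E_def by (intro X_order_diff assms(3))
qed

text \<open>This is the partial derivative of the velocity with respect to \<open>w\<close> at
  equilibrium, as \<open>velocity_derivative\<close> confirms.\<close>

definition c :: field_family where
  "c = (\<lambda>\<epsilon> t x. - (deriv a (H (\<rho> \<epsilon> t x)) * pressure \<gamma> (\<rho> \<epsilon> t x) * (1 / \<rho> \<epsilon> t x)))"

lemma X_order_c: "X_order 1 K 0 c"
  using X_order_minus [OF X_order_mult [OF X_order_mult [OF X_order_deriv_a_H
        X_order_2D [OF X_order_pressure]] X_order_2D [OF X_order_inverse]]]
  by (simp add: c_def)

text \<open>Since \<open>c * \<rho>\<^sup>2 * H' = - \<mu>\<close>, the added term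
  \<open>\<epsilon>\<close> times the diffusive flux is the negative of the leading part of
  \<open>u * d\<close>.\<close>

lemma diffusive_flux_c:
  "\<rho> \<epsilon> t x > 0 \<Longrightarrow> diffusive_flux \<gamma> a H (\<rho> \<epsilon>) (z \<epsilon>) u t x
    = - (u t x * (c \<epsilon> t x * (\<rho> \<epsilon> t x * \<rho> \<epsilon> t x * deriv H (\<rho> \<epsilon> t x) * Dx (v0 \<epsilon>) t x)))"
  by (simp add: diffusive_flux_def v0_def c_def diff_coeff_def)

section \<open>Estimates for the flux remainder and the balance law\<close>

lemma flux_remainder_d:
  "flux_remainder \<gamma> a H \<epsilon> (\<rho> \<epsilon>) (z \<epsilon>) (w \<epsilon>) u t x
    = u t x * d \<epsilon> t x + \<epsilon> * diffusive_flux \<gamma> a H (\<rho> \<epsilon>) (z \<epsilon>) u t x"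
  by (simp add: flux_remainder_def d_def v_def v0_def algebra_simps)

text \<open>Once the leading terms have cancelled, \<open>u * (c * \<epsilon> * E - T * P)\<close>
  is left, with \<open>T\<close> the Taylor remainder of \<open>a\<close> and \<open>P\<close> the
  pressure. The first product gains one order from \<open>\<epsilon>\<close> and one from
  \<open>E\<close>; \<open>T\<close> is quadratic in \<open>h - H \<rho>\<close>.\<close>

lemma flux_remainder_order:
  assumes "X_order 2 K 0 u"
  shows "O_eps K 2 (\<lambda>\<epsilon>. flux_remainder \<gamma> a H \<epsilon> (\<rho> \<epsilon>) (z \<epsilon>) (w \<epsilon>) (u \<epsilon>))"
proof -
  define T where "T = (\<lambda>\<epsilon> t x. a (h \<epsilon> t x) - a (H (\<rho> \<epsilon> t x))
    - deriv a (H (\<rho> \<epsilon> t x)) * (h \<epsilon> t x - H (\<rho> \<epsilon> t x)))"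
  have "O_eps K (0 + 2) (\<lambda>\<epsilon> t x. u \<epsilon> t x * (c \<epsilon> t x * (\<epsilon> * E \<epsilon> t x) + - 1 * (T \<epsilon> t x * pressure \<gamma> (\<rho> \<epsilon> t x))))"
  proof (intro O_eps_mult O_eps_add X_order_O_eps [OF assms])
    have "O_eps K (0 + (1 + 1)) (\<lambda>\<epsilon> t x. c \<epsilon> t x * (\<epsilon> * E \<epsilon> t x))"
      using X_order_E [of 0] X_order_d X_order_e O_eps_Dt_e
      by (intro O_eps_mult O_eps_parameter X_order_O_eps [OF X_order_c]) simp_all
    then show "O_eps K 2 (\<lambda>\<epsilon> t x. c \<epsilon> t x * (\<epsilon> * E \<epsilon> t x))" by (simp add: numeral_2_eq_2)
    have "O_eps K (0 + (2 + 0)) (\<lambda>\<epsilon> t x. - 1 * (T \<epsilon> t x * pressure \<gamma> (\<rho> \<epsilon> t x)))"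
      unfolding T_def
      by (intro O_eps_mult O_eps_const O_eps_second_increment X_order_O_eps [OF X_order_pressure])
    then show "O_eps K 2 (\<lambda>\<epsilon> t x. - 1 * (T \<epsilon> t x * pressure \<gamma> (\<rho> \<epsilon> t x)))"
      by (simp only: add_0 add_0_right)
  qed
  moreover have "near K (\<lambda>\<epsilon> t y. u \<epsilon> t y * (c \<epsilon> t y * (\<epsilon> * E \<epsilon> t y) + - 1 * (T \<epsilon> t y * pressure \<gamma> (\<rho> \<epsilon> t y)))
    = flux_remainder \<gamma> a H \<epsilon> (\<rho> \<epsilon>) (z \<epsilon>) (w \<epsilon>) (u \<epsilon>) t y)"
  proof (rule near_mono [OF near_conj [OF near_pos near_conj [OF near_e near_d]]], elim conjE)
    fix \<epsilon> t y
    define X where "X = \<rho> \<epsilon> t y * \<rho> \<epsilon> t y * deriv H (\<rho> \<epsilon> t y) * Dx (v0 \<epsilon>) t y"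
    assume r: "\<rho> \<epsilon> t y > 0"
      and e: "e \<epsilon> t y = \<epsilon> * (\<rho> \<epsilon> t y * \<rho> \<epsilon> t y * deriv H (\<rho> \<epsilon> t y) * Dx (v0 \<epsilon>) t y + E \<epsilon> t y)"
      and d: "d \<epsilon> t y = - ((a (h \<epsilon> t y) - a (H (\<rho> \<epsilon> t y))) * pressure \<gamma> (\<rho> \<epsilon> t y))"
    have "deriv a (H (\<rho> \<epsilon> t y)) * (h \<epsilon> t y - H (\<rho> \<epsilon> t y)) * pressure \<gamma> (\<rho> \<epsilon> t y) = - c \<epsilon> t y * e \<epsilon> t y"
      using r by (simp add: h_def e_def c_def W_eq_def field_simps)
    then have d': "d \<epsilon> t y = c \<epsilon> t y * (\<epsilon> * (X + E \<epsilon> t y)) - T \<epsilon> t y * pressure \<gamma> (\<rho> \<epsilon> t y)"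
      using e unfolding d T_def X_def by (simp add: algebra_simps)
    show "u \<epsilon> t y * (c \<epsilon> t y * (\<epsilon> * E \<epsilon> t y) + - 1 * (T \<epsilon> t y * pressure \<gamma> (\<rho> \<epsilon> t y)))
      = flux_remainder \<gamma> a H \<epsilon> (\<rho> \<epsilon>) (z \<epsilon>) (w \<epsilon>) (u \<epsilon>) t y"
      unfolding flux_remainder_d diffusive_flux_c [OF r] X_def [symmetric] d'
      by (simp add: algebra_simps)
  qed
  ultimately show ?thesis
    unfolding add_0 by (rule X_order_cong [where k = 0, simplified, rotated])
qed

text \<open>The order 1 is not sharp. What matters is spatial differentiability near
  \<open>K\<close>, which gives meaning to the derivative of the remainder in the balance
  law.\<close>

lemma X_order_flux_remainder:
  assumes "X_order 2 K 0 u"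
  shows "X_order 1 K 1 (\<lambda>\<epsilon>. flux_remainder \<gamma> a H \<epsilon> (\<rho> \<epsilon>) (z \<epsilon>) (w \<epsilon>) (u \<epsilon>))"
proof -
  have "X_order 1 K 1 (\<lambda>\<epsilon> t x. u \<epsilon> t x * d \<epsilon> t x)"
    using X_order_mult [OF X_order_2D [OF assms] X_order_d] by (simp only: add_0)
  moreover have "X_order 1 K 1 (\<lambda>\<epsilon> t x. \<epsilon> * diffusive_flux \<gamma> a H (\<rho> \<epsilon>) (z \<epsilon>) (u \<epsilon>) t x)"
    using X_order_mult [OF X_order_parameter X_order_diffusive_flux [OF assms]] by (simp only: add_0_right)
  ultimately show ?thesis
    unfolding flux_remainder_d by (rule X_order_add)
qed

text \<open>The exact flux is \<open>u v0 + u d\<close>, and \<open>u d\<close> equals the remainder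
  minus \<open>\<epsilon>\<close> times the diffusive flux; the conservation law for
  \<open>u\<close> then only has to be rearranged.\<close>

lemma near_balance:
  assumes "X_order 2 K 0 u"
    and "near K (\<lambda>\<epsilon> t y. Dt (u \<epsilon>) t y + Dx (\<lambda>t x. u \<epsilon> t x * v \<epsilon> t x) t y = 0)"
  shows "near K (\<lambda>\<epsilon> t y. (\<lambda>s. flux_remainder \<gamma> a H \<epsilon> (\<rho> \<epsilon>) (z \<epsilon>) (w \<epsilon>) (u \<epsilon>) t s) differentiable at y \<and>
    equilibrium_part \<gamma> a H (\<rho> \<epsilon>) (z \<epsilon>) (u \<epsilon>) t y =
      \<epsilon> * Dx (diffusive_flux \<gamma> a H (\<rho> \<epsilon>) (z \<epsilon>) (u \<epsilon>)) t y
      - Dx (flux_remainder \<gamma> a H \<epsilon> (\<rho> \<epsilon>) (z \<epsilon>) (w \<epsilon>) (u \<epsilon>)) t y)"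
proof (rule near_mono [OF near_conj [OF near_conj [OF assms(2)
      X_order_1_differentiable [OF X_order_flux_remainder [OF assms(1)]]]
      near_conj [OF near_conj [OF X_order_2_differentiable [OF assms(1)]
      X_order_1_differentiable [OF X_order_diffusive_flux [OF assms(1)]]]
      near_conj [OF X_order_1_differentiable [OF X_order_d] X_order_2_differentiable [OF X_order_v0]]]]],
    elim conjE, rule conjI)
  fix \<epsilon> t y
  let ?F = "diffusive_flux \<gamma> a H (\<rho> \<epsilon>) (z \<epsilon>) (u \<epsilon>)"
  assume R: "(\<lambda>s. flux_remainder \<gamma> a H \<epsilon> (\<rho> \<epsilon>) (z \<epsilon>) (w \<epsilon>) (u \<epsilon>) t s) differentiable at y"
    and eq: "Dt (u \<epsilon>) t y + Dx (\<lambda>t x. u \<epsilon> t x * v \<epsilon> t x) t y = 0"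
    and s: "u \<epsilon> t differentiable at y" "?F t differentiable at y"
      "d \<epsilon> t differentiable at y" "v0 \<epsilon> t differentiable at y"
  show "(\<lambda>s. flux_remainder \<gamma> a H \<epsilon> (\<rho> \<epsilon>) (z \<epsilon>) (w \<epsilon>) (u \<epsilon>) t s) differentiable at y" by fact
  have "flux_remainder \<gamma> a H \<epsilon> (\<rho> \<epsilon>) (z \<epsilon>) (w \<epsilon>) (u \<epsilon>) = (\<lambda>t x. u \<epsilon> t x * d \<epsilon> t x + \<epsilon> * ?F t x)"
    by (intro ext) (rule flux_remainder_d)
  then have "Dx (flux_remainder \<gamma> a H \<epsilon> (\<rho> \<epsilon>) (z \<epsilon>) (w \<epsilon>) (u \<epsilon>)) t y
      = Dx (\<lambda>t x. u \<epsilon> t x * d \<epsilon> t x) t y + \<epsilon> * Dx ?F t y"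
    using s by (simp add: Dx_add Dx_cmult)
  moreover have "Dx (\<lambda>t x. u \<epsilon> t x * v \<epsilon> t x) t y
      = Dx (\<lambda>t x. u \<epsilon> t x * v0 \<epsilon> t x) t y + Dx (\<lambda>t x. u \<epsilon> t x * d \<epsilon> t x) t y"
    using s by (simp add: v_eq_d distrib_left Dx_add)
  moreover have "equilibrium_part \<gamma> a H (\<rho> \<epsilon>) (z \<epsilon>) (u \<epsilon>) t y
      = Dt (u \<epsilon>) t y + Dx (\<lambda>t x. u \<epsilon> t x * v0 \<epsilon> t x) t y"
    by (simp add: equilibrium_part_def v0_def)
  ultimately show "equilibrium_part \<gamma> a H (\<rho> \<epsilon>) (z \<epsilon>) (u \<epsilon>) t y =
      \<epsilon> * Dx ?F t y - Dx (flux_remainder \<gamma> a H \<epsilon> (\<rho> \<epsilon>) (z \<epsilon>) (w \<epsilon>) (u \<epsilon>)) t y"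
    using eq by simp
qed

text \<open>Links the first-order velocity term in the convention, which is written with
  \<open>deriv (velocity ...)\<close>, to the coefficient \<open>c\<close> of the estimates.\<close>

lemma velocity_derivative:
  assumes "\<rho> \<epsilon> t x > 0"
  shows "deriv (velocity \<gamma> a (\<rho> \<epsilon> t x) \<zeta>) (W_eq H (\<rho> \<epsilon> t x)) = c \<epsilon> t x"
proof (rule DERIV_imp_deriv)
  have "W_eq H (\<rho> \<epsilon> t x) / \<rho> \<epsilon> t x = H (\<rho> \<epsilon> t x)"
    using assms by (simp add: W_eq_def)
  moreover have "a differentiable at (H (\<rho> \<epsilon> t x))"
    using a_regular H_regular [OF assms] by (simp add: numeral_2_eq_2)
  ultimately have "((\<lambda>\<omega>. a (\<omega> / \<rho> \<epsilon> t x)) has_real_derivative deriv a (H (\<rho> \<epsilon> t x)) * (1 / \<rho> \<epsilon> t x))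
      (at (W_eq H (\<rho> \<epsilon> t x)))"
    by (intro DERIV_chain2 [of a] DERIV_cdivide DERIV_ident)
      (simp add: DERIV_deriv_iff_real_differentiable)
  from DERIV_diff [OF DERIV_const DERIV_mult [OF this DERIV_const], of "\<zeta> / \<rho> \<epsilon> t x" "pressure \<gamma> (\<rho> \<epsilon> t x)"]
  show "(velocity \<gamma> a (\<rho> \<epsilon> t x) \<zeta> has_real_derivative c \<epsilon> t x) (at (W_eq H (\<rho> \<epsilon> t x)))"
    by (simp add: velocity_def [abs_def] c_def algebra_simps)
qed

text \<open>Differentiating the Taylor remainder of \<open>a\<close> would leave \<open>(a' h - a'
  (H \<rho>) - a'' (H \<rho>) * (h - H \<rho>)) * Dx (H \<rho>)\<close>, in general only
  o(\<open>\<epsilon>\<close>). The remainder is therefore decomposed as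
  \<open>u * (d2 + c * (\<epsilon> * E - e2))\<close>, where the rates of \<open>d2\<close> and
  \<open>e2\<close> are given and that of \<open>E\<close> follows from the convention.\<close>

lemma Dx_flux_remainder_order:
  assumes u: "X_order 2 K 0 u" and otd: "order_terms_differentiable \<gamma> a H K \<rho> z w G"
  shows "O_eps K 2 (\<lambda>\<epsilon>. Dx (flux_remainder \<gamma> a H \<epsilon> (\<rho> \<epsilon>) (z \<epsilon>) (w \<epsilon>) (u \<epsilon>)))"
proof -
  \<comment> \<open>\<open>d2'\<close> is literally the quantity bounded by the convention;
    \<open>d2\<close> is the same with the derivative of the velocity replaced by \<open>c\<close>.
    They agree where the density is positive.\<close>
  define d2 where "d2 = (\<lambda>\<epsilon> t x. d \<epsilon> t x - \<epsilon> * (c \<epsilon> t x * w1 \<epsilon> t x))"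
  define d2' where "d2' = (\<lambda>\<epsilon> t x. v \<epsilon> t x - (v0 \<epsilon> t x
    + \<epsilon> * (deriv (velocity \<gamma> a (\<rho> \<epsilon> t x) (z \<epsilon> t x)) (W_eq H (\<rho> \<epsilon> t x)) * w1 \<epsilon> t x)))"
  have bounds_e: "O_eps_diff 2 K 1 e" and bounds_d: "O_eps_diff 2 K 1 d" and bounds_d2: "O_eps_diff 1 K 2 d2'"
    using otd unfolding order_terms_differentiable_def Let_def
    by (simp_all only: e_def d_def v_def v0_def d2'_def w1_def)
  have C1_w: "\<forall>\<^sub>F \<epsilon> in at_right 0. C_k_field (Suc 0) \<Omega> (Dx (w \<epsilon>))" "\<forall>\<^sub>F \<epsilon> in at_right 0. C_k_field (Suc 0) \<Omega> (Dt (w \<epsilon>))"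
    "\<forall>\<^sub>F \<epsilon> in at_right 0. C_k_field (Suc 0) \<Omega> (Dt (\<rho> \<epsilon>))"
    using C2_w C2(1) unfolding numeral_2_eq_2 by (auto elim: eventually_mono)
  note diff_w = C1_w [THEN C_k_field_near_differentiable [OF domain]]
  \<comment> \<open>The time derivative of \<open>W_eq H \<rho>\<close> is expanded by the chain
    rule, so that the spatial differentiability of \<open>Dt e\<close> can be reduced to that of
    \<open>deriv H\<close> and \<open>Dt \<rho>\<close>.\<close>
  have near_De: "near K (\<lambda>\<epsilon> t y. Dx (w \<epsilon>) t y - Dx (\<lambda>t x. W_eq H (\<rho> \<epsilon> t x)) t y = Dx (e \<epsilon>) t y \<and>
      Dt (w \<epsilon>) t y - (H (\<rho> \<epsilon> t y) + \<rho> \<epsilon> t y * deriv H (\<rho> \<epsilon> t y)) * Dt (\<rho> \<epsilon>) t y = Dt (e \<epsilon>) t y)"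
    by (rule near_mono [OF near_conj [OF near_smooth near_W]]) (simp add: e_def Dx_diff Dt_diff)
  \<comment> \<open>The convention bounds the second derivatives of \<open>e\<close>; that they
    exist follows from the regularity of \<open>w\<close> and of
    \<open>W_eq H \<rho>\<close>.\<close>
  have X_e: "X_order 2 K 1 e"
  proof -
    have "near K (\<lambda>\<epsilon> t y. (\<lambda>s. Dx (w \<epsilon>) t s - Dx (\<lambda>t x. W_eq H (\<rho> \<epsilon> t x)) t s) differentiable at y)"
      using near_conj [OF diff_w(1) X_order_1_differentiable, of 0 "\<lambda>\<epsilon>. Dx (\<lambda>t x. W_eq H (\<rho> \<epsilon> t x))"] X_order_W
      by (auto simp: numeral_2_eq_2 elim: near_mono)
    from near_conj [OF this near_near [OF near_De]]
    have "near K (\<lambda>\<epsilon> t y. Dx (e \<epsilon>) t differentiable at y)"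
      by (rule near_mono) (auto elim!: differentiable_cong_nhds [rotated] eventually_mono)
    then show ?thesis
      using bounds_e X_order_1_differentiable [OF X_order_e] by (simp add: numeral_2_eq_2)
  qed
  have X_Dt_e: "X_order 1 K 1 (\<lambda>\<epsilon>. Dt (e \<epsilon>))"
  proof -
    have "X_order 1 K 0 (\<lambda>\<epsilon> t x. H (\<rho> \<epsilon> t x) + \<rho> \<epsilon> t x * deriv H (\<rho> \<epsilon> t x))"
      using X_order_add [OF X_order_2D [OF X_order_H] X_order_mult [OF X_order_2D [OF X_order_\<rho>] X_order_deriv_H, unfolded add_0_right]] .
    from near_conj [OF X_order_1_differentiable [OF this] near_conj [OF diff_w(2,3)]]
    have "near K (\<lambda>\<epsilon> t y. (\<lambda>s. Dt (w \<epsilon>) t s - (H (\<rho> \<epsilon> t s) + \<rho> \<epsilon> t s * deriv H (\<rho> \<epsilon> t s)) * Dt (\<rho> \<epsilon>) t s) differentiable at y)"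
      by (rule near_mono) (auto intro!: differentiable_diff differentiable_mult)
    from near_conj [OF this near_near [OF near_De]]
    have "near K (\<lambda>\<epsilon> t y. Dt (e \<epsilon>) t differentiable at y)"
      by (rule near_mono) (auto elim!: differentiable_cong_nhds [rotated] eventually_mono)
    then show ?thesis
      using bounds_e by (simp add: numeral_2_eq_2)
  qed
  \<comment> \<open>Composition alone gives order 0 but two derivatives. Together with the bounds of
    the convention this gives order 1; the same combination works for \<open>d2\<close>
    below.\<close>
  have X_d: "X_order 2 K 1 d"
  proof -
    have "X_order 2 K 0 (\<lambda>\<epsilon> t x. a (h \<epsilon> t x))"
      by (rule X_order_h_fun [OF a_regular X_order_h(2) [OF X_e order_refl]])
    from X_order_minus [OF X_order_mult [OF X_order_diff [OF this X_order_a_H] X_order_pressure]]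
    have "X_order 2 K 0 (\<lambda>\<epsilon> t x. - ((a (h \<epsilon> t x) - a (H (\<rho> \<epsilon> t x))) * pressure \<gamma> (\<rho> \<epsilon> t x)))"
      by (simp only: add_0_right)
    then have "X_order 2 K 0 d"
      by (rule X_order_cong [OF near_mono [OF near_d], rotated]) simp
    then show ?thesis using bounds_d by (simp add: numeral_2_eq_2)
  qed
  have X_E: "X_order 1 K 1 E"
    using X_order_E [of 1] X_d X_e X_Dt_e by (simp add: numeral_2_eq_2)
  have "X_order 1 K 0 d2"
  proof -
    have "X_order 1 K 0 (\<lambda>\<epsilon> t x. \<epsilon> * (c \<epsilon> t x * w1 \<epsilon> t x))"
      using X_order_mult [OF X_order_parameter X_order_mult [OF X_order_c X_order_w1]]
      by (rule X_order_mono) simp_all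
    then show ?thesis
      unfolding d2_def by (rule X_order_diff [OF X_order_mono [OF X_order_d order_refl, of 0], rotated]) simp
  qed
  moreover have near_d2: "near K (\<lambda>\<epsilon> t y. d2' \<epsilon> t y = d2 \<epsilon> t y)"
    by (rule near_mono [OF near_pos]) (simp add: d2_def d2'_def d_def velocity_derivative)
  then have "O_eps K 2 d2" "O_eps K 2 (\<lambda>\<epsilon>. Dx (d2 \<epsilon>))"
    using X_order_cong [of K d2' d2 0] X_order_cong [OF near_Dx_cong, of K d2' d2 0] bounds_d2 by auto
  ultimately have X_d2: "X_order 1 K 2 d2" by simp
  have "X_order 1 K (0 + 2) (\<lambda>\<epsilon> t x. c \<epsilon> t x * (\<epsilon> * E \<epsilon> t x - e2 \<epsilon> t x))"
  proof (rule X_order_mult [OF X_order_c X_order_diff [OF _ X_order_e2]])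
    show "X_order 1 K 2 (\<lambda>\<epsilon> t x. \<epsilon> * E \<epsilon> t x)"
      using X_order_mult [OF X_order_parameter X_E] by (simp only: one_add_one)
  qed
  from X_order_mult [OF X_order_2D [OF u] X_order_add [OF X_d2 this [unfolded add_0]]]
  have "X_order 1 K 2 (\<lambda>\<epsilon> t x. u \<epsilon> t x * (d2 \<epsilon> t x + c \<epsilon> t x * (\<epsilon> * E \<epsilon> t x - e2 \<epsilon> t x)))"
    by (simp only: add_0)
  moreover have "near K (\<lambda>\<epsilon> t y. u \<epsilon> t y * (d2 \<epsilon> t y + c \<epsilon> t y * (\<epsilon> * E \<epsilon> t y - e2 \<epsilon> t y))
      = flux_remainder \<gamma> a H \<epsilon> (\<rho> \<epsilon>) (z \<epsilon>) (w \<epsilon>) (u \<epsilon>) t y)"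
  proof (rule near_mono [OF near_conj [OF near_pos near_e]], elim conjE)
    fix \<epsilon> t y
    define X where "X = \<rho> \<epsilon> t y * \<rho> \<epsilon> t y * deriv H (\<rho> \<epsilon> t y) * Dx (v0 \<epsilon>) t y"
    assume r: "\<rho> \<epsilon> t y > 0"
      and e: "e \<epsilon> t y = \<epsilon> * (\<rho> \<epsilon> t y * \<rho> \<epsilon> t y * deriv H (\<rho> \<epsilon> t y) * Dx (v0 \<epsilon>) t y + E \<epsilon> t y)"
    \<comment> \<open>The first-order term drops out of the sum: \<open>d2\<close> contains
      \<open>- \<epsilon> * c * w1\<close>, and \<open>- c * e2\<close> contains its
      negative.\<close>
    have e2: "e2 \<epsilon> t y = \<epsilon> * (X + E \<epsilon> t y) - \<epsilon> * w1 \<epsilon> t y"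
      using e unfolding e_e2 X_def by simp
    show "u \<epsilon> t y * (d2 \<epsilon> t y + c \<epsilon> t y * (\<epsilon> * E \<epsilon> t y - e2 \<epsilon> t y))
      = flux_remainder \<gamma> a H \<epsilon> (\<rho> \<epsilon>) (z \<epsilon>) (w \<epsilon>) (u \<epsilon>) t y"
      unfolding flux_remainder_d diffusive_flux_c [OF r] X_def [symmetric] d2_def e2
      by (simp add: algebra_simps)
  qed
  ultimately have "X_order 1 K 2 (\<lambda>\<epsilon>. flux_remainder \<gamma> a H \<epsilon> (\<rho> \<epsilon>) (z \<epsilon>) (w \<epsilon>) (u \<epsilon>))"
    by (rule X_order_cong [rotated])
  then show ?thesis by (rule X_order_1_Dx)
qed

lemma expansion:
  assumes u: "u \<in> {\<rho>, z}"
  shows "O_eps K 2 (\<lambda>\<epsilon>. flux_remainder \<gamma> a H \<epsilon> (\<rho> \<epsilon>) (z \<epsilon>) (w \<epsilon>) (u \<epsilon>))" (is ?order)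
    and "\<forall>\<^sub>F \<epsilon> in at_right 0. \<forall>(t, x)\<in>K.
       (\<lambda>y. flux_remainder \<gamma> a H \<epsilon> (\<rho> \<epsilon>) (z \<epsilon>) (w \<epsilon>) (u \<epsilon>) t y) differentiable at x \<and>
       equilibrium_part \<gamma> a H (\<rho> \<epsilon>) (z \<epsilon>) (u \<epsilon>) t x =
         \<epsilon> * Dx (diffusive_flux \<gamma> a H (\<rho> \<epsilon>) (z \<epsilon>) (u \<epsilon>)) t x
         - Dx (flux_remainder \<gamma> a H \<epsilon> (\<rho> \<epsilon>) (z \<epsilon>) (w \<epsilon>) (u \<epsilon>)) t x" (is ?balance)
    and "order_terms_differentiable \<gamma> a H K \<rho> z w G \<Longrightarrow> O_eps K 2 (\<lambda>\<epsilon> t x.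
       equilibrium_part \<gamma> a H (\<rho> \<epsilon>) (z \<epsilon>) (u \<epsilon>) t x
       - \<epsilon> * Dx (diffusive_flux \<gamma> a H (\<rho> \<epsilon>) (z \<epsilon>) (u \<epsilon>)) t x)"
proof -
  have X: "X_order 2 K 0 u"
    using u X_order_\<rho> X_order_z by auto
  have "near K (\<lambda>\<epsilon> t y. Dt (u \<epsilon>) t y + Dx (\<lambda>t x. u \<epsilon> t x * v \<epsilon> t x) t y = 0)"
    using u by (auto intro: near_mono [OF near_relaxed])
  note balance = near_balance [OF X this]
  show ?order by (rule flux_remainder_order [OF X])
  show ?balance by (rule near_at [OF balance])
  assume "order_terms_differentiable \<gamma> a H K \<rho> z w G"
  from O_eps_mult [OF O_eps_const [of K "-1"] Dx_flux_remainder_order [OF X this]]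
  have "O_eps K 2 (\<lambda>\<epsilon> t x. - Dx (flux_remainder \<gamma> a H \<epsilon> (\<rho> \<epsilon>) (z \<epsilon>) (w \<epsilon>) (u \<epsilon>)) t x)"
    by (simp only: add_0 mult_minus1)
  then show "O_eps K 2 (\<lambda>\<epsilon> t x.
       equilibrium_part \<gamma> a H (\<rho> \<epsilon>) (z \<epsilon>) (u \<epsilon>) t x
       - \<epsilon> * Dx (diffusive_flux \<gamma> a H (\<rho> \<epsilon>) (z \<epsilon>) (u \<epsilon>)) t x)"
    by (rule X_order_cong [where k = 0, simplified, rotated])
      (rule near_mono [OF balance], simp)
qed

end

section \<open>Matrix form and eigenvalues\<close>

lemma has_vector_derivative_vector_2:
  fixes f g :: "real \<Rightarrow> real"
  assumes "(f has_real_derivative f') (at x)" "(g has_real_derivative g') (at x)"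
  shows "((\<lambda>y. vector [f y, g y] :: real^2) has_vector_derivative vector [f', g']) (at x)"
proof -
  \<comment> \<open>As a combination of constant axis vectors the pair is accessible to the
    derivative rules for sums and scalar multiples.\<close>
  have v: "(vector [p, q] :: real^2) = p *\<^sub>R axis 1 1 + q *\<^sub>R axis 2 1" for p q :: real
    by (simp add: vec_eq_iff forall_2 axis_def)
  have "((\<lambda>y. f y *\<^sub>R (axis 1 1 :: real^2) + g y *\<^sub>R axis 2 1)
      has_vector_derivative f' *\<^sub>R axis 1 1 + g' *\<^sub>R axis 2 1) (at x)"
    using assms by (auto intro!: derivative_eq_intros)
  then show ?thesis by (simp add: v)
qed

lemma vector_derivative_vector_2:
  fixes f g :: "real \<Rightarrow> real" and F :: "real \<Rightarrow> real^2"
  assumes "\<forall>\<^sub>F y in nhds x. F y = vector [f y, g y]" "f differentiable at x" "g differentiable at x"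
  shows "vector_derivative F (at x) = vector [deriv f x, deriv g x]"
proof -
  have "((\<lambda>y. vector [f y, g y] :: real^2) has_vector_derivative vector [deriv f x, deriv g x]) (at x)"
    using assms(2,3) by (intro has_vector_derivative_vector_2) (simp_all add: DERIV_deriv_iff_real_differentiable)
  then have "(F has_vector_derivative vector [deriv f x, deriv g x]) (at x)"
    by (subst has_vector_derivative_cong_ev [where g = "\<lambda>y. vector [f y, g y]"])
      (use assms(1) eventually_nhds_x_imp_x [OF assms(1)] in simp_all)
  then show ?thesis by (rule vector_derivative_at)
qed

text \<open>An eigenvector is a nonzero kernel element of \<open>mat k - A\<close>; for a square
  matrix such an element exists exactly when the matrix is singular.\<close>

lemma eigenvalue_of_iff_det: "eigenvalue_of A k \<longleftrightarrow> det (mat k - A) = 0" for A :: "real^'n^'n"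
proof -
  have "mat k *v x = k *\<^sub>R x" for x :: "real^'n"
    by (simp add: vec_eq_iff matrix_vector_mult_def mat_def mult_delta_left)
  then have "(mat k - A) *v x = k *\<^sub>R x - A *v x" for x
    by (simp add: matrix_vector_mult_diff_rdistrib)
  then show ?thesis
    using invertible_det_nz [of "mat k - A"] invertible_left_inverse [of "mat k - A"]
      matrix_left_invertible_ker [of "mat k - A"]
    unfolding eigenvalue_of_def by auto
qed

context constitutive
begin

lemma slice:
  assumes "open \<Omega>" "C_k_field 2 \<Omega> \<rho>" "C_k_field 2 \<Omega> z" "\<forall>(t, x)\<in>\<Omega>. \<rho> t x > 0" "(t, x) \<in> \<Omega>"
  shows "\<forall>\<^sub>F y in nhds x. \<rho> t y > 0 \<and> \<rho> t differentiable at y \<and> z t differentiable at y \<and>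
    diffusive_flux \<gamma> a H \<rho> z \<rho> t differentiable at y \<and> diffusive_flux \<gamma> a H \<rho> z z t differentiable at y \<and>
    (\<lambda>s. v_eq \<gamma> a H (\<rho> t s) (z t s)) differentiable at y"
proof -
  \<comment> \<open>For fields independent of \<open>\<epsilon>\<close> on a single point all bounds are trivial, so the calculus of
    orders yields pure differentiability.\<close>
  interpret bounded_states \<gamma> a H \<Omega> "{(t, x)}" "\<lambda>\<epsilon>. \<rho>" "\<lambda>\<epsilon>. z"
    by unfold_locales (use assms in \<open>simp_all add: O_eps_diff_singleton O_eps_singleton\<close>)
  have "near {(t, x)} (\<lambda>\<epsilon> t y. \<rho> t y > 0 \<and> \<rho> t differentiable at y \<and> z t differentiable at y \<and>
    diffusive_flux \<gamma> a H \<rho> z \<rho> t differentiable at y \<and> diffusive_flux \<gamma> a H \<rho> z z t differentiable at y \<and>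
    (\<lambda>s. v_eq \<gamma> a H (\<rho> t s) (z t s)) differentiable at y)"
    by (rule near_mono [OF near_conj [OF near_conj [OF near_pos near_conj [OF
        X_order_2_differentiable [OF X_order_\<rho>] X_order_2_differentiable [OF X_order_z]]]
        near_conj [OF near_conj [OF X_order_1_differentiable [OF X_order_diffusive_flux [OF X_order_\<rho>]]
        X_order_1_differentiable [OF X_order_diffusive_flux [OF X_order_z]]]
        X_order_2_differentiable [OF X_order_v0]]]]) (simp add: v0_def)
  then show ?thesis by (simp add: near_def)
qed

text \<open>Multiplication by the density clears the denominators. As
  \<open>v_eq + Q_eq = z / \<rho>\<close>, the coefficients on the right are the first row of the
  diffusion matrix divided by \<open>\<mu>\<close>.\<close>

lemma Dx_v_eq:
  assumes "\<rho> t y > 0" "\<rho> t differentiable at y" "z t differentiable at y" "\<forall>\<^sub>F s in nhds y. \<rho> t s > 0"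
  shows "\<rho> t y * Dx (\<lambda>t x. v_eq \<gamma> a H (\<rho> t x) (z t x)) t y
    = Dx z t y - (z t y / \<rho> t y + q_eq \<gamma> a H (\<rho> t y)) * Dx \<rho> t y"
proof -
  have D: "(\<rho> t has_real_derivative Dx \<rho> t y) (at y)" "(z t has_real_derivative Dx z t y) (at y)"
    using assms(2,3) by (simp_all add: Dx_def DERIV_deriv_iff_real_differentiable)
  have Q: "(Q_eq \<gamma> a H has_real_derivative deriv (Q_eq \<gamma> a H) (\<rho> t y)) (at (\<rho> t y))"
    using Q_eq_derivative [OF assms(1)] DERIV_imp_deriv by metis
  have "\<forall>\<^sub>F s in nhds y. v_eq \<gamma> a H (\<rho> t s) (z t s) = z t s / \<rho> t s - Q_eq \<gamma> a H (\<rho> t s)"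
    using assms(4) by eventually_elim (rule v_eq_Q)
  then have "Dx (\<lambda>t x. v_eq \<gamma> a H (\<rho> t x) (z t x)) t y
      = deriv (\<lambda>s. z t s / \<rho> t s - Q_eq \<gamma> a H (\<rho> t s)) y"
    unfolding Dx_def by (rule deriv_cong_ev) simp
  also have "\<dots> = (Dx z t y * \<rho> t y - z t y * Dx \<rho> t y) / (\<rho> t y * \<rho> t y)
      - deriv (Q_eq \<gamma> a H) (\<rho> t y) * Dx \<rho> t y"
    using assms(1)
    by (intro DERIV_imp_deriv DERIV_diff DERIV_divide D DERIV_chain2 [of "Q_eq \<gamma> a H" _ "\<rho> t", OF Q]) simp
  finally show ?thesis
    using assms(1) by (simp add: q_eq_def field_simps)
qed

lemma state_nth: "state \<rho> z t x $ 1 = \<rho> t x" "state \<rho> z t x $ 2 = z t x"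
  by (simp_all add: state_def)

lemma f_eq_state:
  "\<rho> t x > 0 \<Longrightarrow> f_eq \<gamma> a H (state \<rho> z t x)
    = vector [\<rho> t x * v_eq \<gamma> a H (\<rho> t x) (z t x), z t x * v_eq \<gamma> a H (\<rho> t x) (z t x)]"
  by (simp add: f_eq_def state_nth v_eq_Q Let_def power2_eq_square right_diff_distrib)

lemma
  assumes "open \<Omega>" "C_k_field 2 \<Omega> \<rho>" "C_k_field 2 \<Omega> z" "\<forall>(t, x)\<in>\<Omega>. \<rho> t x > 0" "(t, x) \<in> \<Omega>"
  shows transport_matrix_form:
    "vector_derivative (\<lambda>s. state \<rho> z s x) (at t) + vector_derivative (\<lambda>y. f_eq \<gamma> a H (state \<rho> z t y)) (at x)
      = vector [equilibrium_part \<gamma> a H \<rho> z \<rho> t x, equilibrium_part \<gamma> a H \<rho> z z t x]" (is ?transport)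
    and flux_matrix_form:
    "\<forall>\<^sub>F y in nhds x. diff_matrix \<gamma> a H (state \<rho> z t y) *v vector_derivative (\<lambda>y. state \<rho> z t y) (at y)
      = vector [diffusive_flux \<gamma> a H \<rho> z \<rho> t y, diffusive_flux \<gamma> a H \<rho> z z t y]" (is ?flux)
    and diffusion_matrix_form:
    "vector_derivative
       (\<lambda>y. diff_matrix \<gamma> a H (state \<rho> z t y) *v vector_derivative (\<lambda>y'. state \<rho> z t y') (at y)) (at x)
      = vector [Dx (diffusive_flux \<gamma> a H \<rho> z \<rho>) t x, Dx (diffusive_flux \<gamma> a H \<rho> z z) t x]" (is ?diffusion)
proof -
  note ev = slice [OF assms]
  have at: "\<rho> t differentiable at x" "z t differentiable at x"
    "(\<lambda>s. v_eq \<gamma> a H (\<rho> t s) (z t s)) differentiable at x"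
    "diffusive_flux \<gamma> a H \<rho> z \<rho> t differentiable at x" "diffusive_flux \<gamma> a H \<rho> z z t differentiable at x"
    using eventually_nhds_x_imp_x [OF ev] by simp_all
  have "(\<lambda>s. \<rho> s x) differentiable at t" "(\<lambda>s. z s x) differentiable at t"
    using assms(2,3,5) by (auto simp: numeral_2_eq_2)
  then have "vector_derivative (\<lambda>s. state \<rho> z s x) (at t) = vector [Dt \<rho> t x, Dt z t x]"
    unfolding Dt_def by (intro vector_derivative_vector_2) (simp_all add: state_def)
  moreover have "vector_derivative (\<lambda>y. f_eq \<gamma> a H (state \<rho> z t y)) (at x)
    = vector [Dx (\<lambda>t x. \<rho> t x * v_eq \<gamma> a H (\<rho> t x) (z t x)) t x, Dx (\<lambda>t x. z t x * v_eq \<gamma> a H (\<rho> t x) (z t x)) t x]"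
    unfolding Dx_def using at
    by (intro vector_derivative_vector_2 eventually_mono [OF ev]) (simp_all add: f_eq_state)
  ultimately show ?transport
    by (simp add: equilibrium_part_def vec_eq_iff forall_2)
  \<comment> \<open>The formula for \<open>v_eq\<close> is differentiated at \<open>y\<close>
    itself, so positivity is required around every nearby \<open>y\<close>, not just around
    \<open>x\<close>.\<close>
  have "\<forall>\<^sub>F y in nhds x. \<forall>\<^sub>F s in nhds y. \<rho> t s > 0"
    using ev unfolding eventually_eventually by (rule eventually_mono) simp
  with ev show ?flux
  proof eventually_elim
    case (elim y)
    define v where "v = Dx (\<lambda>t x. v_eq \<gamma> a H (\<rho> t x) (z t x)) t y"
    have v: "\<rho> t y * v = Dx z t y - (z t y / \<rho> t y + q_eq \<gamma> a H (\<rho> t y)) * Dx \<rho> t y"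
      unfolding v_def by (rule Dx_v_eq) (use elim in auto)
    \<comment> \<open>The second row is \<open>z / \<rho>\<close> times the first, so both flux
      components reduce to the same expression; this rank-one structure is also the origin of the
      eigenvalue 0.\<close>
    have "z t y * v = z t y / \<rho> t y * (\<rho> t y * v)" using elim by simp
    note zv = this [unfolded v]
    have "vector_derivative (\<lambda>y. state \<rho> z t y) (at y) = vector [Dx \<rho> t y, Dx z t y]"
      unfolding Dx_def using elim by (intro vector_derivative_vector_2) (simp_all add: state_def)
    moreover have "v_eq \<gamma> a H (\<rho> t y) (z t y) + Q_eq \<gamma> a H (\<rho> t y) = z t y / \<rho> t y"
      using elim by (simp add: v_eq_Q)
    moreover have flux: "diffusive_flux \<gamma> a H \<rho> z u t y = diff_coeff \<gamma> a H (\<rho> t y) * (u t y * v)" for u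
      by (simp add: diffusive_flux_def v_def)
    ultimately show ?case
      unfolding diff_matrix_def Let_def state_nth flux v zv
      by (simp add: vec_eq_iff forall_2 matrix_vector_mult_def sum_2 algebra_simps)
  qed
  then show ?diffusion
    unfolding Dx_def using at(4,5) by (rule vector_derivative_vector_2)
qed

text \<open>The rows are proportional, so the determinant vanishes and the characteristic polynomial
  is \<open>k\<close> times \<open>k\<close> minus the trace. In the trace \<open>v + Q\<close>
  cancels, which leaves \<open>- \<mu> * q\<close>.\<close>

lemma eigenvalues:
  fixes r \<zeta> :: real
  defines "D \<equiv> diff_matrix \<gamma> a H (vector [r, \<zeta>])"
    and "l \<equiv> (lambda1_eq \<gamma> a H r (v_eq \<gamma> a H r \<zeta>) - lambda1_f \<gamma> a H r (v_eq \<gamma> a H r \<zeta>)) * q_eq \<gamma> a H r"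
  assumes "r > 0"
  shows "det (mat k - D) = k * (k - l)" and "{k. eigenvalue_of D k} = {0, l}"
    and "l = - diff_coeff \<gamma> a H r * q_eq \<gamma> a H r"
proof -
  \<comment> \<open>By the product rule for \<open>Q\<close>, the gap between \<open>q\<close> and
    \<open>a (H \<rho>) P' \<rho>\<close> is exactly \<open>\<mu>\<close>; hence the difference of
    the two characteristic speeds is \<open>- \<mu>\<close>.\<close>
  have "q_eq \<gamma> a H r = diff_coeff \<gamma> a H r + a (H r) * deriv (pressure \<gamma>) r * r"
    unfolding q_eq_def diff_coeff_def DERIV_imp_deriv [OF Q_eq_derivative [OF assms(3)]]
    by (simp add: algebra_simps)
  then show l: "l = - diff_coeff \<gamma> a H r * q_eq \<gamma> a H r"
    by (simp add: l_def lambda1_eq_def lambda1_f_def)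
  show det: "det (mat k - D) = k * (k - l)" for k
    unfolding l D_def diff_matrix_def Let_def by (simp add: det_2 mat_def algebra_simps)
  show "{k. eigenvalue_of D k} = {0, l}"
    by (auto simp: eigenvalue_of_iff_det det)
qed

end

theorem theorem4p2:
  fixes \<gamma> :: real and a H :: "real \<Rightarrow> real"
  assumes "\<gamma> > 0"
    and "H differentiable_on {0<..}" and "deriv H C1_differentiable_on {0<..}"
    and "\<forall>r>0. \<exists>\<delta>>0. a differentiable_on ball (H r) \<delta> \<and>
                        deriv a C1_differentiable_on ball (H r) \<delta>"
  shows
    "(\<forall>\<Omega> K \<rho> z w G. chapman_enskog_family \<gamma> a H \<Omega> K \<rho> z w G \<longrightarrow>
        (\<forall>u\<in>{\<rho>, z}.
          O_eps K 2 (\<lambda>\<epsilon>. flux_remainder \<gamma> a H \<epsilon> (\<rho> \<epsilon>) (z \<epsilon>) (w \<epsilon>) (u \<epsilon>)) \<and>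
          (\<forall>\<^sub>F \<epsilon> in at_right 0. \<forall>(t, x)\<in>K.
             (\<lambda>y. flux_remainder \<gamma> a H \<epsilon> (\<rho> \<epsilon>) (z \<epsilon>) (w \<epsilon>) (u \<epsilon>) t y) differentiable at x \<and>
             equilibrium_part \<gamma> a H (\<rho> \<epsilon>) (z \<epsilon>) (u \<epsilon>) t x =
               \<epsilon> * Dx (diffusive_flux \<gamma> a H (\<rho> \<epsilon>) (z \<epsilon>) (u \<epsilon>)) t x
               - Dx (flux_remainder \<gamma> a H \<epsilon> (\<rho> \<epsilon>) (z \<epsilon>) (w \<epsilon>) (u \<epsilon>)) t x) \<and>
          (order_terms_differentiable \<gamma> a H K \<rho> z w G \<longrightarrow>
             O_eps K 2 (\<lambda>\<epsilon> t x.
               equilibrium_part \<gamma> a H (\<rho> \<epsilon>) (z \<epsilon>) (u \<epsilon>) t x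
               - \<epsilon> * Dx (diffusive_flux \<gamma> a H (\<rho> \<epsilon>) (z \<epsilon>) (u \<epsilon>)) t x)))) \<and>
     (\<forall>r>0. deriv (\<lambda>s. a (H s)) r < 0 \<longrightarrow> diff_coeff \<gamma> a H r < 0) \<and>
     (\<forall>\<Omega> \<epsilon> \<rho> z. open \<Omega> \<longrightarrow> C_k_field 2 \<Omega> \<rho> \<longrightarrow> C_k_field 2 \<Omega> z \<longrightarrow>
        (\<forall>(t, x)\<in>\<Omega>. \<rho> t x > 0) \<longrightarrow>
        (\<forall>(t, x)\<in>\<Omega>.
           vector_derivative (\<lambda>s. state \<rho> z s x) (at t)
             + vector_derivative (\<lambda>y. f_eq \<gamma> a H (state \<rho> z t y)) (at x)
           = vector [equilibrium_part \<gamma> a H \<rho> z \<rho> t x, equilibrium_part \<gamma> a H \<rho> z z t x] \<and>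
           diff_matrix \<gamma> a H (state \<rho> z t x) *v vector_derivative (\<lambda>y. state \<rho> z t y) (at x)
           = vector [diffusive_flux \<gamma> a H \<rho> z \<rho> t x, diffusive_flux \<gamma> a H \<rho> z z t x]) \<and>
        (first_order_correction \<gamma> a H \<Omega> \<epsilon> \<rho> z \<longleftrightarrow>
           first_order_correction_matrix \<gamma> a H \<Omega> \<epsilon> (state \<rho> z))) \<and>
     (\<forall>r>0. \<forall>\<zeta>.
        let D = diff_matrix \<gamma> a H (vector [r, \<zeta>]); v = v_eq \<gamma> a H r \<zeta>;
            l2 = (lambda1_eq \<gamma> a H r v - lambda1_f \<gamma> a H r v) * q_eq \<gamma> a H r
        in (\<forall>c. det (mat c - D) = c * (c - l2)) \<and>
           {c. eigenvalue_of D c} = {0, l2} \<and>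
           l2 = - diff_coeff \<gamma> a H r * q_eq \<gamma> a H r)"
proof -
  \<comment> \<open>The half-line and the balls are open, so \<open>C_fun_2_iff\<close> converts the
    smoothness assumptions.\<close>
  interpret constitutive \<gamma> a H
    by unfold_locales (use assms in \<open>simp_all add: C_fun_2_iff\<close>)
  have "\<forall>u\<in>{\<rho>, z}.
      O_eps K 2 (\<lambda>\<epsilon>. flux_remainder \<gamma> a H \<epsilon> (\<rho> \<epsilon>) (z \<epsilon>) (w \<epsilon>) (u \<epsilon>)) \<and>
      (\<forall>\<^sub>F \<epsilon> in at_right 0. \<forall>(t, x)\<in>K.
         (\<lambda>y. flux_remainder \<gamma> a H \<epsilon> (\<rho> \<epsilon>) (z \<epsilon>) (w \<epsilon>) (u \<epsilon>) t y) differentiable at x \<and>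
         equilibrium_part \<gamma> a H (\<rho> \<epsilon>) (z \<epsilon>) (u \<epsilon>) t x =
           \<epsilon> * Dx (diffusive_flux \<gamma> a H (\<rho> \<epsilon>) (z \<epsilon>) (u \<epsilon>)) t x
           - Dx (flux_remainder \<gamma> a H \<epsilon> (\<rho> \<epsilon>) (z \<epsilon>) (w \<epsilon>) (u \<epsilon>)) t x) \<and>
      (order_terms_differentiable \<gamma> a H K \<rho> z w G \<longrightarrow>
         O_eps K 2 (\<lambda>\<epsilon> t x.
           equilibrium_part \<gamma> a H (\<rho> \<epsilon>) (z \<epsilon>) (u \<epsilon>) t x
           - \<epsilon> * Dx (diffusive_flux \<gamma> a H (\<rho> \<epsilon>) (z \<epsilon>) (u \<epsilon>)) t x))"
    if "chapman_enskog_family \<gamma> a H \<Omega> K \<rho> z w G" for \<Omega> K \<rho> z w G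
  proof -
    interpret chapman_enskog \<gamma> a H \<Omega> K \<rho> z w G
      by unfold_locales (rule that)
    show ?thesis using expansion by blast
  qed
  moreover have "first_order_correction \<gamma> a H \<Omega> \<epsilon> \<rho> z \<longleftrightarrow>
      first_order_correction_matrix \<gamma> a H \<Omega> \<epsilon> (state \<rho> z)"
    if "open \<Omega>" "C_k_field 2 \<Omega> \<rho>" "C_k_field 2 \<Omega> z" "\<forall>(t, x)\<in>\<Omega>. \<rho> t x > 0" for \<Omega> \<epsilon> \<rho> z
    unfolding first_order_correction_def first_order_correction_matrix_def
  proof (intro ball_cong refl, clarify)
    fix t x assume "(t, x) \<in> \<Omega>"
    show "(equilibrium_part \<gamma> a H \<rho> z \<rho> t x = \<epsilon> * Dx (diffusive_flux \<gamma> a H \<rho> z \<rho>) t x \<and>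
        equilibrium_part \<gamma> a H \<rho> z z t x = \<epsilon> * Dx (diffusive_flux \<gamma> a H \<rho> z z) t x) \<longleftrightarrow>
      vector_derivative (\<lambda>s. state \<rho> z s x) (at t) +
        vector_derivative (\<lambda>y. f_eq \<gamma> a H (state \<rho> z t y)) (at x) =
      \<epsilon> *\<^sub>R vector_derivative
          (\<lambda>y. diff_matrix \<gamma> a H (state \<rho> z t y) *v vector_derivative (\<lambda>y'. state \<rho> z t y') (at y)) (at x)"
      unfolding transport_matrix_form [OF that \<open>(t, x) \<in> \<Omega>\<close>] diffusion_matrix_form [OF that \<open>(t, x) \<in> \<Omega>\<close>]
      by (simp add: vec_eq_iff forall_2)
  qed
  moreover have "vector_derivative (\<lambda>s. state \<rho> z s x) (at t)
        + vector_derivative (\<lambda>y. f_eq \<gamma> a H (state \<rho> z t y)) (at x)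
      = vector [equilibrium_part \<gamma> a H \<rho> z \<rho> t x, equilibrium_part \<gamma> a H \<rho> z z t x] \<and>
      diff_matrix \<gamma> a H (state \<rho> z t x) *v vector_derivative (\<lambda>y. state \<rho> z t y) (at x)
      = vector [diffusive_flux \<gamma> a H \<rho> z \<rho> t x, diffusive_flux \<gamma> a H \<rho> z z t x]"
    if "open \<Omega>" "C_k_field 2 \<Omega> \<rho>" "C_k_field 2 \<Omega> z" "\<forall>(t, x)\<in>\<Omega>. \<rho> t x > 0" "(t, x) \<in> \<Omega>"
    for \<Omega> \<rho> z t x
    using transport_matrix_form [OF that] eventually_nhds_x_imp_x [OF flux_matrix_form [OF that]] ..
  ultimately show ?thesis
    unfolding Let_def using diff_coeff_neg eigenvalues by (intro conjI allI impI ballI case_prodI2) auto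
qed

end
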